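(* The space $\mathcal{GH}^{<\omega}$ of isometry classes of finite metric spaces endowed with the Gromov-Hausdorff distance cannot be coarsely embedded into any uniformly convex Banach space, and so, in particular, into any Hilbert space.
   Context: Metric spaces are nonempty. A correspondence between sets $X,Y$ is a relation $\mathcal{R}\subseteq X\times Y$ such that every $x\in X$ is related to at least one $y\in Y$ and vice versa. For a metric space $(Z,d)$ and $X,Y\subseteq Z$, the Hausdorff distance is $d_H(X,Y)=\inf_{\mathcal{R}\subseteq X\times Y\text{ correspondence}}\sup_{(x,y)\in\mathcal{R}}d(x,y)$. The Gromov-Hausdorff distance $d_{GH}(X,Y)$ of two metric spaces is the infimum of $d_H(i_X(X),i_Y(Y))$ over all metric spaces $Z$ and isometric embeddings $i_X\colon X\to Z$, $i_Y\colon Y\to Z$. Equivalently, $d_{GH}(X,Y)=\frac12\inf_{\mathcal{R}}\sup_{(x_1,y_1),(x_2,y_2)\in\mathcal{R}}|d_X(x_1,x_2)-d_Y(y_1,y_2)|$ over correspondences $\mathcal{R}$. The distance between isometry classes is the distance between representatives; $d_{GH}$ is a metric on isometry classes of finite metric spaces. A map $\psi\colon(X,d_X)\to(Y,d_Y)$ between metric spaces is a coarse embedding if there are maps $\rho_-,\rho_+\colon\mathbb{R}_{\ge0}\to\mathbb{R}_{\ge0}$ with $\rho_-(t)\to\infty$ as $t\to\infty$ such that $\rho_-(d_X(x,y))\le d_Y(\psi(x),\psi(y))\le\rho_+(d_X(x,y))$ for all $x,y\in X$. A Banach space $(A,\|\cdot\|)$ is uniformly convex if for every $0<\varepsilon\le2$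 there is $\delta>0$ such that for all $x,y\in A$ with $\|x\|=\|y\|=1$, $\|x-y\|\ge\varepsilon$ implies $\|(x+y)/2\|\le1-\delta$. *)

theory Defs
  imports "HOL-Analysis.Analysis"
begin

section \<open>The Gromov-Hausdorff distance\<close>

definition correspondence :: "'a set \<Rightarrow> 'b set \<Rightarrow> ('a \<times> 'b) set \<Rightarrow> bool" where
  "correspondence X Y R \<longleftrightarrow>
     R \<subseteq> X \<times> Y \<and> (\<forall>x\<in>X. \<exists>y\<in>Y. (x, y) \<in> R) \<and> (\<forall>y\<in>Y. \<exists>x\<in>X. (x, y) \<in> R)"

text \<open>Infima and suprema are taken in the complete lattice of extended reals, so that no
  boundedness conditions are needed.\<close>

definition hausdorff_distance :: "'a metric \<Rightarrow> 'a set \<Rightarrow> 'a set \<Rightarrow> ereal" where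
  "hausdorff_distance Z A B =
     (INF R \<in> {R. correspondence A B R}. SUP (x, y) \<in> R. ereal (mdist Z x y))"

definition isometric_embedding :: "'a metric \<Rightarrow> 'b metric \<Rightarrow> ('a \<Rightarrow> 'b) \<Rightarrow> bool" where
  "isometric_embedding X Z f \<longleftrightarrow>
     f \<in> mspace X \<rightarrow> mspace Z \<and>
     (\<forall>x\<in>mspace X. \<forall>y\<in>mspace X. mdist Z (f x) (f y) = mdist X x y)"

text \<open>The ambient space \<open>Z\<close> ranges over the metric spaces carried by subsets of the sum type.
  Since only the union of the two images matters, this loses nothing compared with ambient
  spaces over arbitrary types: see \<open>GH_distance_le_hausdorff_distance\<close> below.\<close>

definition GH_distance :: "'a metric \<Rightarrow> 'b metric \<Rightarrow> ereal" where
  "GH_distance X Y =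
     (INF (Z :: ('a + 'b) metric, i, j) \<in>
            {(Z, i, j). isometric_embedding X Z i \<and> isometric_embedding Y Z j}.
        hausdorff_distance Z (i ` mspace X) (j ` mspace Y))"

definition distortion_le :: "'a metric \<Rightarrow> 'b metric \<Rightarrow> ('a \<times> 'b) set \<Rightarrow> real \<Rightarrow> bool" where
  "distortion_le X Y R c \<longleftrightarrow>
     (\<forall>x y x' y'. (x, y) \<in> R \<longrightarrow> (x', y') \<in> R \<longrightarrow> \<bar>mdist X x x' - mdist Y y y'\<bar> \<le> c)"

lemma mdist_self [simp]: "x \<in> mspace X \<Longrightarrow> mdist X x x = 0"
  by simp

lemma hausdorff_distance_lessE:
  assumes i: "isometric_embedding X Z i" and j: "isometric_embedding Y Z j"
    and less: "hausdorff_distance Z (i ` mspace X) (j ` mspace Y) < ereal c"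
  obtains R where "correspondence (mspace X) (mspace Y) R" "distortion_le X Y R (2 * c)"
proof -
  from less obtain S where S: "correspondence (i ` mspace X) (j ` mspace Y) S"
    and Sc: "(SUP (x, y) \<in> S. ereal (mdist Z x y)) < ereal c"
    unfolding hausdorff_distance_def INF_less_iff by blast
  have d: "mdist Z x y \<le> c" if "(x, y) \<in> S" for x y
  proof -
    have "ereal (mdist Z x y) \<le> (SUP (x, y) \<in> S. ereal (mdist Z x y))"
      using that by (intro SUP_upper2[of "(x, y)"]) auto
    with Sc show ?thesis by (metis ereal_less_eq(3) less_imp_le order_trans)
  qed
  define R where "R = {(x, y). x \<in> mspace X \<and> y \<in> mspace Y \<and> (i x, j y) \<in> S}"
  have "correspondence (mspace X) (mspace Y) R"
    using S unfolding correspondence_def R_def by blast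
  moreover have "distortion_le X Y R (2 * c)"
    unfolding distortion_le_def
  proof (intro allI impI)
    fix x y x' y' assume "(x, y) \<in> R" "(x', y') \<in> R"
    then have mem: "x \<in> mspace X" "x' \<in> mspace X" "y \<in> mspace Y" "y' \<in> mspace Y"
      and le: "mdist Z (i x) (j y) \<le> c" "mdist Z (i x') (j y') \<le> c"
      by (auto simp: R_def d)
    have Z: "i x \<in> mspace Z" "i x' \<in> mspace Z" "j y \<in> mspace Z" "j y' \<in> mspace Z"
      using i j mem by (auto simp: isometric_embedding_def)
    have eq: "mdist X x x' = mdist Z (i x) (i x')" "mdist Y y y' = mdist Z (j y) (j y')"
      using i j mem by (auto simp: isometric_embedding_def)
    have "mdist Z (i x) (i x') \<le> mdist Z (i x) (j y) + mdist Z (j y) (j y') + mdist Z (i x') (j y')"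
      using mdist_triangle[OF Z(1,3,2)] mdist_triangle[OF Z(3,4,2)]
      by (simp add: mdist_commute)
    moreover have "mdist Z (j y) (j y') \<le> mdist Z (i x) (j y) + mdist Z (i x) (i x') + mdist Z (i x') (j y')"
      using mdist_triangle[OF Z(3,1,4)] mdist_triangle[OF Z(1,2,4)] mdist_commute[of Z "i x" "j y"]
      by linarith
    ultimately show "\<bar>mdist X x x' - mdist Y y y'\<bar> \<le> 2 * c"
      unfolding eq using le by linarith
  qed
  ultimately show ?thesis by (rule that)
qed

lemma GH_distance_le_pos:
  fixes X :: "'a metric" and Y :: "'b metric"
  assumes ne: "mspace X \<noteq> {}" and R: "correspondence (mspace X) (mspace Y) R"
    and dis: "distortion_le X Y R (2 * c)" and c: "c > 0"
  shows "GH_distance X Y \<le> ereal c"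
proof -
  define h where "h x y = (\<lambda>(a, b). mdist X x a + mdist Y b y)" for x y
  define g where "g x y = c + (INF p\<in>R. h x y p)" for x y
  have Rne: "R \<noteq> {}" and Rsub: "\<And>a b. (a, b) \<in> R \<Longrightarrow> a \<in> mspace X \<and> b \<in> mspace Y"
    using ne R unfolding correspondence_def by blast+
  have bdd: "bdd_below (h x y ` R)" for x y
    by (rule bdd_belowI[of _ 0]) (auto simp: h_def)
  have g_le: "g x y \<le> c + (mdist X x a + mdist Y b y)" if "(a, b) \<in> R" for x y a b
    using cINF_lower[OF bdd that, of x y] by (simp add: g_def h_def)
  have g_ge: "t \<le> g x y" if "\<And>a b. (a, b) \<in> R \<Longrightarrow> t \<le> c + (mdist X x a + mdist Y b y)" for t x y
  proof -
    have "t - c \<le> (INF p\<in>R. h x y p)"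
      using that by (intro cINF_greatest[OF Rne]) (force simp: h_def)
    then show ?thesis by (simp add: g_def)
  qed
  have g_c: "c \<le> g x y" for x y by (rule g_ge) simp
  define d where "d u v = (case (u, v) of
      (Inl x, Inl x') \<Rightarrow> mdist X x x' | (Inl x, Inr y) \<Rightarrow> g x y
    | (Inr y, Inl x) \<Rightarrow> g x y | (Inr y, Inr y') \<Rightarrow> mdist Y y y')" for u v
  have d_simps [simp]: "d (Inl x) (Inl x') = mdist X x x'" "d (Inl x) (Inr y) = g x y"
    "d (Inr y) (Inl x) = g x y" "d (Inr y) (Inr y') = mdist Y y y'" for x x' y y'
    by (simp_all add: d_def)
  define M where "M = mspace X <+> mspace Y"
  have M_iff [simp]: "Inl x \<in> M \<longleftrightarrow> x \<in> mspace X" "Inr y \<in> M \<longleftrightarrow> y \<in> mspace Y" for x y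
    by (auto simp: M_def)
  have tX: "g x y \<le> mdist X x x' + g x' y"
    if "x \<in> mspace X" "x' \<in> mspace X" "y \<in> mspace Y" for x x' y
  proof -
    have "g x y - mdist X x x' \<le> g x' y"
    proof (rule g_ge)
      fix a b assume "(a, b) \<in> R"
      with g_le[OF this, of x y] Rsub[OF this] mdist_triangle[of x X x' a] that
      show "g x y - mdist X x x' \<le> c + (mdist X x' a + mdist Y b y)" by auto
    qed
    then show ?thesis by simp
  qed
  have tY: "g x y \<le> g x y' + mdist Y y' y"
    if "x \<in> mspace X" "y \<in> mspace Y" "y' \<in> mspace Y" for x y y'
  proof -
    have "g x y - mdist Y y' y \<le> g x y'"
    proof (rule g_ge)
      fix a b assume "(a, b) \<in> R"
      with g_le[OF this, of x y] Rsub[OF this] mdist_triangle[of b Y y' y] that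
      show "g x y - mdist Y y' y \<le> c + (mdist X x a + mdist Y b y')" by auto
    qed
    then show ?thesis by simp
  qed
  have tXX: "mdist X x x' \<le> g x y + g x' y"
    if "x \<in> mspace X" "x' \<in> mspace X" "y \<in> mspace Y" for x x' y
  proof -
    have "mdist X x x' - g x' y \<le> g x y"
    proof (rule g_ge)
      fix a b assume ab: "(a, b) \<in> R"
      have "mdist X x x' - (c + (mdist X x a + mdist Y b y)) \<le> g x' y"
      proof (rule g_ge)
        fix a' b' assume ab': "(a', b') \<in> R"
        have "mdist X a a' \<le> mdist Y b b' + 2 * c"
          using dis ab ab' unfolding distortion_le_def by (smt (verit))
        with mdist_triangle[of x X a x'] mdist_triangle[of a X a' x'] mdist_triangle[of b Y y b']
          mdist_commute[of X x' a'] mdist_commute[of Y y b'] Rsub[OF ab] Rsub[OF ab'] that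
        show "mdist X x x' - (c + (mdist X x a + mdist Y b y)) \<le> c + (mdist X x' a' + mdist Y b' y)"
          by linarith
      qed
      then show "mdist X x x' - g x' y \<le> c + (mdist X x a + mdist Y b y)" by linarith
    qed
    then show ?thesis by simp
  qed
  have tYY: "mdist Y y y' \<le> g x y + g x y'"
    if "x \<in> mspace X" "y \<in> mspace Y" "y' \<in> mspace Y" for x y y'
  proof -
    have "mdist Y y y' - g x y' \<le> g x y"
    proof (rule g_ge)
      fix a b assume ab: "(a, b) \<in> R"
      have "mdist Y y y' - (c + (mdist X x a + mdist Y b y)) \<le> g x y'"
      proof (rule g_ge)
        fix a' b' assume ab': "(a', b') \<in> R"
        have "mdist Y b b' \<le> mdist X a a' + 2 * c"
          using dis ab ab' unfolding distortion_le_def by (smt (verit))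
        with mdist_triangle[of y Y b y'] mdist_triangle[of b Y b' y'] mdist_triangle[of a X x a']
          mdist_commute[of Y y b] mdist_commute[of X x a] Rsub[OF ab] Rsub[OF ab'] that
        show "mdist Y y y' - (c + (mdist X x a + mdist Y b y)) \<le> c + (mdist X x a' + mdist Y b' y')"
          by linarith
      qed
      then show "mdist Y y y' - g x y' \<le> c + (mdist X x a + mdist Y b y)" by linarith
    qed
    then show ?thesis by simp
  qed
  interpret Z: Metric_space M d
  proof
    show "0 \<le> d u v" for u v
      using c g_c by (cases u; cases v) (auto intro: order_trans[OF less_imp_le])
    show "d u v = d v u" for u v
      by (cases u; cases v) (auto simp: mdist_commute)
    have "g x y \<noteq> 0" for x y using c g_c[of x y] by linarith
    then show "d u v = 0 \<longleftrightarrow> u = v" if "u \<in> M" "v \<in> M" for u v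
      using that by (cases u; cases v) auto
    show "d u w \<le> d u v + d v w" if "u \<in> M" "v \<in> M" "w \<in> M" for u v w
    proof (cases u; cases v; cases w)
      fix x y z assume "u = Inl x" "v = Inl y" "w = Inl z"
      then show ?thesis using that by (simp add: mdist_triangle)
    next
      fix x y z assume "u = Inl x" "v = Inl y" "w = Inr z"
      then show ?thesis using that tX[of x y z] by simp
    next
      fix x y z assume "u = Inl x" "v = Inr y" "w = Inl z"
      then show ?thesis using that tXX[of x z y] by simp
    next
      fix x y z assume "u = Inl x" "v = Inr y" "w = Inr z"
      then show ?thesis using that tY[of x z y] by simp
    next
      fix x y z assume "u = Inr x" "v = Inl y" "w = Inl z"
      then show ?thesis using that tX[of z y x] by (simp add: mdist_commute[of X y z])
    next
      fix x y z assume "u = Inr x" "v = Inl y" "w = Inr z"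
      then show ?thesis using that tYY[of y x z] by simp
    next
      fix x y z assume "u = Inr x" "v = Inr y" "w = Inl z"
      then show ?thesis using that tY[of z x y] by (simp add: mdist_commute[of Y x y])
    next
      fix x y z assume "u = Inr x" "v = Inr y" "w = Inr z"
      then show ?thesis using that by (simp add: mdist_triangle)
    qed
  qed
  define Z where "Z = metric (M, d)"
  have Z: "mspace Z = M" "mdist Z = d" by (simp_all add: Z_def)
  have emb: "isometric_embedding X Z Inl" "isometric_embedding Y Z Inr"
    by (auto simp: isometric_embedding_def Z)
  define S where "S = (\<lambda>(x, y). (Inl x :: 'a + 'b, Inr y :: 'a + 'b)) ` R"
  have S: "correspondence (Inl ` mspace X) (Inr ` mspace Y) S"
    using R unfolding correspondence_def S_def by force
  have "GH_distance X Y \<le> hausdorff_distance Z (Inl ` mspace X) (Inr ` mspace Y)"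
    unfolding GH_distance_def by (rule INF_lower2[of "(Z, Inl, Inr)"]) (use emb in auto)
  also have "\<dots> \<le> (SUP (x, y) \<in> S. ereal (mdist Z x y))"
    unfolding hausdorff_distance_def by (rule INF_lower) (use S in simp)
  also have "\<dots> \<le> ereal c"
  proof (rule SUP_least, clarify)
    fix u v assume "(u, v) \<in> S"
    then obtain x y where xy: "(x, y) \<in> R" and uv: "u = Inl x" "v = Inr y" by (auto simp: S_def)
    show "ereal (mdist Z u v) \<le> ereal c"
      using g_le[OF xy, of x y] Rsub[OF xy] by (simp add: Z uv)
  qed
  finally show ?thesis .
qed

lemma distortion_le_mono: "distortion_le X Y R c \<Longrightarrow> c \<le> c' \<Longrightarrow> distortion_le X Y R c'"
  unfolding distortion_le_def by (meson order_trans)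

lemma GH_distance_le:
  assumes ne: "mspace X \<noteq> {}" and R: "correspondence (mspace X) (mspace Y) R"
    and dis: "distortion_le X Y R (2 * c)"
  shows "GH_distance X Y \<le> ereal c"
proof -
  obtain x y where xy: "(x, y) \<in> R" using ne R unfolding correspondence_def by blast
  then have c: "c \<ge> 0" using dis R unfolding distortion_le_def correspondence_def by force
  show ?thesis
  proof (rule ereal_le_epsilon2)
    fix e :: real assume "e > 0"
    with c GH_distance_le_pos[OF ne R distortion_le_mono[OF dis, of "2 * (c + e)"]]
    show "GH_distance X Y \<le> ereal c + ereal e" by simp
  qed
qed

lemma GH_distance_lessE:
  fixes X :: "'a metric" and Y :: "'b metric"
  assumes "GH_distance X Y < ereal c"
  obtains R where "correspondence (mspace X) (mspace Y) R" "distortion_le X Y R (2 * c)"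
proof -
  from assms obtain Z :: "('a + 'b) metric" and i j
    where ij: "isometric_embedding X Z i" "isometric_embedding Y Z j"
      and less: "hausdorff_distance Z (i ` mspace X) (j ` mspace Y) < ereal c"
    unfolding GH_distance_def INF_less_iff by auto
  show ?thesis by (rule hausdorff_distance_lessE[OF ij less]) (rule that)
qed

lemma GH_distance_le_hausdorff_distance:
  fixes Z :: "'z metric"
  assumes ne: "mspace X \<noteq> {}"
    and "isometric_embedding X Z i" "isometric_embedding Y Z j"
  shows "GH_distance X Y \<le> hausdorff_distance Z (i ` mspace X) (j ` mspace Y)"
proof (rule dense_ge)
  fix r assume r: "hausdorff_distance Z (i ` mspace X) (j ` mspace Y) < r"
  then obtain c where c: "hausdorff_distance Z (i ` mspace X) (j ` mspace Y) < ereal c" "ereal c < r"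
    using ereal_dense2 by blast
  from hausdorff_distance_lessE[OF assms(2,3) c(1)] obtain R
    where R: "correspondence (mspace X) (mspace Y) R" "distortion_le X Y R (2 * c)" .
  then have "GH_distance X Y \<le> ereal c" by (rule GH_distance_le[OF ne])
  with c(2) show "GH_distance X Y \<le> r" by simp
qed

lemma GH_distance_eq_distortion:
  assumes ne: "mspace X \<noteq> {}"
  shows "GH_distance X Y =
    (INF R \<in> {R. correspondence (mspace X) (mspace Y) R}.
       SUP ((x, y), (x', y')) \<in> R \<times> R. ereal (\<bar>mdist X x x' - mdist Y y y'\<bar> / 2))" (is "_ = ?r")
proof (rule antisym)
  let ?s = "\<lambda>R. SUP ((x, y), (x', y')) \<in> R \<times> R. ereal (\<bar>mdist X x x' - mdist Y y y'\<bar> / 2)"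
  have upper: "?s R \<le> ereal c \<longleftrightarrow> distortion_le X Y R (2 * c)" for R c
    unfolding distortion_le_def SUP_le_iff by (fastforce simp: field_simps)
  show "GH_distance X Y \<le> ?r"
  proof (rule dense_ge)
    fix r assume "?r < r"
    then obtain c where c: "?r < ereal c" "ereal c < r" using ereal_dense2 by blast
    from c(1) obtain R where R: "correspondence (mspace X) (mspace Y) R" "?s R < ereal c"
      unfolding INF_less_iff by blast
    then have "distortion_le X Y R (2 * c)" using upper less_imp_le by blast
    then have "GH_distance X Y \<le> ereal c" using GH_distance_le[OF ne R(1)] by blast
    with c(2) show "GH_distance X Y \<le> r" by simp
  qed
  show "?r \<le> GH_distance X Y"
  proof (rule dense_ge)
    fix r assume "GH_distance X Y < r"
    then obtain c where c: "GH_distance X Y < ereal c" "ereal c < r" using ereal_dense2 by blast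
    from GH_distance_lessE[OF c(1)] obtain R
      where R: "correspondence (mspace X) (mspace Y) R" "distortion_le X Y R (2 * c)" .
    have "?r \<le> ?s R" by (rule INF_lower) (use R in simp)
    also have "\<dots> \<le> ereal c" using R(2) upper by blast
    finally show "?r \<le> r" using c(2) by simp
  qed
qed

lemma GH_distance_nonneg:
  assumes "mspace X \<noteq> {}" shows "0 \<le> GH_distance X Y"
proof (rule ccontr)
  assume "\<not> ?thesis"
  then have "GH_distance X Y < ereal 0" by (simp add: zero_ereal_def)
  then obtain c where c: "GH_distance X Y < ereal c" "ereal c < ereal 0"
    using ereal_dense2 by blast
  from GH_distance_lessE[OF c(1)] obtain R
    where R: "correspondence (mspace X) (mspace Y) R" "distortion_le X Y R (2 * c)" .
  obtain x y where "(x, y) \<in> R" using assms R(1) unfolding correspondence_def by blast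
  with R(2) have "\<bar>mdist X x x - mdist Y y y\<bar> \<le> 2 * c" unfolding distortion_le_def by blast
  with c(2) show False by simp
qed

lemma GH_distance_commute:
  assumes "mspace X \<noteq> {}" "mspace Y \<noteq> {}"
  shows "GH_distance X Y = GH_distance Y X"
proof -
  have *: "GH_distance Y X \<le> GH_distance X Y" if ne: "mspace Y \<noteq> {}"
    for X :: "'c metric" and Y :: "'d metric"
  proof (rule dense_ge)
    fix r assume "GH_distance X Y < r"
    then obtain c where c: "GH_distance X Y < ereal c" "ereal c < r" using ereal_dense2 by blast
    from GH_distance_lessE[OF c(1)] obtain R
      where R: "correspondence (mspace X) (mspace Y) R" "distortion_le X Y R (2 * c)" .
    have "correspondence (mspace Y) (mspace X) (R\<inverse>)"
      using R(1) unfolding correspondence_def by blast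
    moreover have "distortion_le Y X (R\<inverse>) (2 * c)"
      using R(2) unfolding distortion_le_def by (auto simp: abs_minus_commute)
    ultimately have "GH_distance Y X \<le> ereal c" by (rule GH_distance_le[OF ne])
    with c(2) show "GH_distance Y X \<le> r" by simp
  qed
  show ?thesis by (intro antisym * assms)
qed

lemma GH_distance_triangle:
  assumes ne: "mspace X \<noteq> {}" "mspace Y \<noteq> {}"
  shows "GH_distance X W \<le> GH_distance X Y + GH_distance Y W"
proof (cases "GH_distance X Y = \<infinity> \<or> GH_distance Y W = \<infinity>")
  case False
  then obtain s t where st: "GH_distance X Y = ereal s" "GH_distance Y W = ereal t"
    using GH_distance_nonneg[OF ne(1), of Y] GH_distance_nonneg[OF ne(2), of W]
    by (cases "GH_distance X Y"; cases "GH_distance Y W") auto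
  have "GH_distance X W \<le> ereal (s + t)"
  proof (rule ereal_le_epsilon2)
    fix e :: real assume "e > 0"
    then have less: "GH_distance X Y < ereal (s + e / 2)" "GH_distance Y W < ereal (t + e / 2)"
      by (simp_all add: st)
    from GH_distance_lessE[OF less(1)] obtain R
      where R: "correspondence (mspace X) (mspace Y) R" "distortion_le X Y R (2 * (s + e / 2))" .
    from GH_distance_lessE[OF less(2)] obtain S
      where S: "correspondence (mspace Y) (mspace W) S" "distortion_le Y W S (2 * (t + e / 2))" .
    have "correspondence (mspace X) (mspace W) (R O S)"
      using R(1) S(1) unfolding correspondence_def by blast
    moreover have "distortion_le X W (R O S) (2 * (s + t + e))"
      unfolding distortion_le_def
    proof (intro allI impI)
      fix x w x' w' assume "(x, w) \<in> R O S" "(x', w') \<in> R O S"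
      then obtain y y' where "(x, y) \<in> R" "(y, w) \<in> S" "(x', y') \<in> R" "(y', w') \<in> S" by blast
      then have "\<bar>mdist X x x' - mdist Y y y'\<bar> \<le> 2 * (s + e / 2)"
        "\<bar>mdist Y y y' - mdist W w w'\<bar> \<le> 2 * (t + e / 2)"
        using R(2) S(2) unfolding distortion_le_def by blast+
      then show "\<bar>mdist X x x' - mdist W w w'\<bar> \<le> 2 * (s + t + e)" by argo
    qed
    ultimately have "GH_distance X W \<le> ereal (s + t + e)" by (rule GH_distance_le[OF ne(1)])
    then show "GH_distance X W \<le> ereal (s + t) + ereal e" by simp
  qed
  then show ?thesis by (simp add: st)
qed (use GH_distance_nonneg[OF ne(1), of Y] GH_distance_nonneg[OF ne(2), of W] in auto)

definition isometric :: "'a metric \<Rightarrow> 'b metric \<Rightarrow> bool" where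
  "isometric X Y \<longleftrightarrow>
     (\<exists>f. bij_betw f (mspace X) (mspace Y) \<and>
          (\<forall>x\<in>mspace X. \<forall>y\<in>mspace X. mdist Y (f x) (f y) = mdist X x y))"

lemma isometric_refl: "isometric X X"
  unfolding isometric_def by (rule exI[of _ id]) auto

lemma isometric_sym:
  assumes "isometric X Y" shows "isometric Y X"
proof -
  obtain f where f: "bij_betw f (mspace X) (mspace Y)"
    "\<forall>x\<in>mspace X. \<forall>y\<in>mspace X. mdist Y (f x) (f y) = mdist X x y"
    using assms unfolding isometric_def by blast
  let ?g = "inv_into (mspace X) f"
  have "bij_betw ?g (mspace Y) (mspace X)" using f(1) by (rule bij_betw_inv_into)
  moreover have "mdist X (?g x) (?g y) = mdist Y x y" if "x \<in> mspace Y" "y \<in> mspace Y" for x y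
  proof -
    have "?g x \<in> mspace X" "?g y \<in> mspace X"
      using that bij_betwE[OF bij_betw_inv_into[OF f(1)]] by blast+
    moreover have "f (?g x) = x" "f (?g y) = y"
      using that bij_betw_inv_into_right[OF f(1)] by blast+
    ultimately show ?thesis using f(2)[rule_format, of "?g x" "?g y"] by simp
  qed
  ultimately show ?thesis unfolding isometric_def by blast
qed

lemma isometric_trans:
  assumes "isometric X Y" "isometric Y W" shows "isometric X W"
proof -
  obtain f g where fg: "bij_betw f (mspace X) (mspace Y)" "bij_betw g (mspace Y) (mspace W)"
    "\<forall>x\<in>mspace X. \<forall>y\<in>mspace X. mdist Y (f x) (f y) = mdist X x y"
    "\<forall>x\<in>mspace Y. \<forall>y\<in>mspace Y. mdist W (g x) (g y) = mdist Y x y"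
    using assms unfolding isometric_def by blast
  have "bij_betw (g \<circ> f) (mspace X) (mspace W)" using fg(1,2) by (rule bij_betw_trans)
  moreover have "\<forall>x\<in>mspace X. \<forall>y\<in>mspace X. mdist W ((g \<circ> f) x) ((g \<circ> f) y) = mdist X x y"
    using fg(3,4) bij_betwE[OF fg(1)] by simp
  ultimately show ?thesis unfolding isometric_def by blast
qed

lemma isometric_imp_GH_distance_zero:
  assumes "mspace X \<noteq> {}" "isometric X Y" shows "GH_distance X Y = 0"
proof -
  obtain f where f: "bij_betw f (mspace X) (mspace Y)"
    "\<forall>x\<in>mspace X. \<forall>y\<in>mspace X. mdist Y (f x) (f y) = mdist X x y"
    using assms unfolding isometric_def by blast
  let ?R = "(\<lambda>x. (x, f x)) ` mspace X"
  have "correspondence (mspace X) (mspace Y) ?R"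
    unfolding correspondence_def bij_betw_imp_surj_on[OF f(1), symmetric] by auto
  moreover have "distortion_le X Y ?R (2 * 0)"
    using f(2) unfolding distortion_le_def by auto
  ultimately have "GH_distance X Y \<le> ereal 0" by (rule GH_distance_le[OF assms(1)])
  then have "GH_distance X Y \<le> 0" by (simp only: zero_ereal_def)
  then show ?thesis using GH_distance_nonneg[OF assms(1)] by (rule antisym)
qed

lemma GH_distance_finite:
  assumes "mspace X \<noteq> {}" "mspace Y \<noteq> {}" "finite (mspace X)" "finite (mspace Y)"
  shows "\<bar>GH_distance X Y\<bar> \<noteq> \<infinity>"
proof -
  let ?R = "mspace X \<times> mspace Y"
  let ?D = "(\<lambda>((x, y), (x', y')). \<bar>mdist X x x' - mdist Y y y'\<bar>) ` (?R \<times> ?R)"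
  have fin: "finite ?D" using assms by auto
  have "correspondence (mspace X) (mspace Y) ?R"
    using assms unfolding correspondence_def by auto
  moreover have "distortion_le X Y ?R (2 * (Max ?D / 2))"
    unfolding distortion_le_def
  proof (intro allI impI)
    fix x y x' y' assume "(x, y) \<in> ?R" "(x', y') \<in> ?R"
    then have "\<bar>mdist X x x' - mdist Y y y'\<bar> \<in> ?D" by force
    then show "\<bar>mdist X x x' - mdist Y y y'\<bar> \<le> 2 * (Max ?D / 2)" using Max_ge[OF fin] by simp
  qed
  ultimately have "GH_distance X Y \<le> ereal (Max ?D / 2)" by (rule GH_distance_le[OF assms(1)])
  with GH_distance_nonneg[OF assms(1), of Y] show ?thesis by auto
qed

lemma GH_distance_zero_imp_isometric:
  assumes fin: "finite (mspace X)" "finite (mspace Y)" and zero: "GH_distance X Y = 0"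
  shows "isometric X Y"
proof -
  let ?Q = "mspace X \<times> mspace Y"
  let ?D = "insert 1 ((\<lambda>((x, y), (x', y')). \<bar>mdist X x x' - mdist Y y y'\<bar>) ` (?Q \<times> ?Q)) - {0}"
  define m where "m = Min ?D"
  have finD: "finite ?D" using fin by auto
  moreover have neD: "1 \<in> ?D" by simp
  ultimately have "m \<in> ?D" unfolding m_def by (intro Min_in) blast+
  then have m: "m > 0" by auto
  then have "GH_distance X Y < ereal (m / 4)" by (simp add: zero)
  then obtain R where R: "correspondence (mspace X) (mspace Y) R" "distortion_le X Y R (2 * (m / 4))"
    by (rule GH_distance_lessE)
  have RQ: "R \<subseteq> ?Q" using R(1) by (simp add: correspondence_def)
  have eq: "mdist X x x' = mdist Y y y'" if "(x, y) \<in> R" "(x', y') \<in> R" for x y x' y'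
  proof (rule ccontr)
    assume "mdist X x x' \<noteq> mdist Y y y'"
    moreover have "((x, y), (x', y')) \<in> ?Q \<times> ?Q" using that RQ by blast
    ultimately have "\<bar>mdist X x x' - mdist Y y y'\<bar> \<in> ?D" by force
    then have "m \<le> \<bar>mdist X x x' - mdist Y y y'\<bar>" unfolding m_def by (rule Min_le[OF finD])
    moreover have "\<bar>mdist X x x' - mdist Y y y'\<bar> \<le> 2 * (m / 4)"
      using R(2) that unfolding distortion_le_def by blast
    ultimately show False using m by simp
  qed
  have "\<forall>x\<in>mspace X. \<exists>y. (x, y) \<in> R" using R(1) unfolding correspondence_def by blast
  then obtain f where f: "\<And>x. x \<in> mspace X \<Longrightarrow> (x, f x) \<in> R" by metis
  have fY: "f x \<in> mspace Y" if "x \<in> mspace X" for x using f[OF that] RQ by blast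
  have iso: "mdist Y (f x) (f x') = mdist X x x'" if "x \<in> mspace X" "x' \<in> mspace X" for x x'
    using eq[OF f[OF that(1)] f[OF that(2)]] by simp
  have "inj_on f (mspace X)"
  proof (rule inj_onI)
    fix x x' assume x: "x \<in> mspace X" "x' \<in> mspace X" and "f x = f x'"
    then have "mdist X x x' = 0" using iso[OF x] mdist_zero[OF fY fY] x by metis
    then show "x = x'" using x by simp
  qed
  moreover have "f ` mspace X = mspace Y"
  proof
    show "mspace Y \<subseteq> f ` mspace X"
    proof
      fix y assume y: "y \<in> mspace Y"
      then obtain x where x: "x \<in> mspace X" "(x, y) \<in> R" using R(1) unfolding correspondence_def by blast
      have "mdist Y (f x) y = 0" using eq[OF f[OF x(1)] x(2)] x(1) by simp
      then have "f x = y" using fY[OF x(1)] y by simp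
      then show "y \<in> f ` mspace X" using x(1) by blast
    qed
  qed (use fY in blast)
  ultimately show ?thesis using iso unfolding isometric_def bij_betw_def by blast
qed

section \<open>The space of isometry classes of finite metric spaces\<close>

text \<open>Every finite metric space is isometric to one carried by a set of natural numbers.\<close>

definition isometric_finite :: "nat metric \<Rightarrow> nat metric \<Rightarrow> bool" where
  "isometric_finite X Y \<longleftrightarrow>
     finite (mspace X) \<and> mspace X \<noteq> {} \<and> finite (mspace Y) \<and> mspace Y \<noteq> {} \<and> isometric X Y"

quotient_type finite_metric_class = "nat metric" / partial: isometric_finite
proof (rule part_equivpI)
  have "Metric_space {0 :: nat} (\<lambda>x y. 0)" by unfold_locales auto
  then have "mspace (metric ({0 :: nat}, \<lambda>x y. 0)) = {0}" by (rule Metric_space.mspace_metric)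
  then have "isometric_finite (metric ({0}, \<lambda>x y. 0)) (metric ({0}, \<lambda>x y. 0))"
    by (simp add: isometric_finite_def isometric_refl)
  then show "\<exists>X. isometric_finite X X" by blast
  show "symp isometric_finite"
    by (auto intro!: sympI simp: isometric_finite_def intro: isometric_sym)
  show "transp isometric_finite"
    by (auto intro!: transpI simp: isometric_finite_def intro: isometric_trans)
qed

instantiation finite_metric_class :: metric_space
begin

lift_definition dist_finite_metric_class :: "finite_metric_class \<Rightarrow> finite_metric_class \<Rightarrow> real"
  is "\<lambda>X Y. real_of_ereal (GH_distance X Y)"
proof -
  fix X X' Y Y' :: "nat metric"
  assume X: "isometric_finite X X'" and Y: "isometric_finite Y Y'"
  have *: "GH_distance X Y \<le> GH_distance X' Y'"
    if X: "isometric_finite X X'" and Y: "isometric_finite Y Y'" for X X' Y Y'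
  proof -
    have ne: "mspace X \<noteq> {}" "mspace X' \<noteq> {}" "mspace Y \<noteq> {}" "mspace Y' \<noteq> {}"
      using X Y by (auto simp: isometric_finite_def)
    have "isometric X X'" "isometric Y' Y"
      using X Y isometric_sym unfolding isometric_finite_def by blast+
    then have "GH_distance X X' = 0" "GH_distance Y' Y = 0"
      using ne by (simp_all only: isometric_imp_GH_distance_zero not_False_eq_True)
    with GH_distance_triangle[OF ne(1,2), of Y] GH_distance_triangle[OF ne(2,4), of Y]
    show ?thesis by simp
  qed
  have "isometric_finite X' X" "isometric_finite Y' Y"
    using X Y by (auto simp: isometric_finite_def intro: isometric_sym)
  then show "real_of_ereal (GH_distance X Y) = real_of_ereal (GH_distance X' Y')"
    using *[OF X Y] *[of X' X Y' Y] by simp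
qed

definition uniformity_finite_metric_class :: "(finite_metric_class \<times> finite_metric_class) filter" where
  "uniformity_finite_metric_class = (INF e\<in>{0 <..}. principal {(x, y). dist x y < e})"

definition open_finite_metric_class :: "finite_metric_class set \<Rightarrow> bool" where
  "open_finite_metric_class U \<longleftrightarrow> (\<forall>x\<in>U. eventually (\<lambda>(x', y). x' = x \<longrightarrow> y \<in> U) uniformity)"

instance
proof
  fix x y z :: finite_metric_class
  show "dist x y = 0 \<longleftrightarrow> x = y"
  proof transfer
    fix X Y :: "nat metric" assume "isometric_finite X X" "isometric_finite Y Y"
    then have XY: "mspace X \<noteq> {}" "mspace Y \<noteq> {}" "finite (mspace X)" "finite (mspace Y)"
      by (auto simp: isometric_finite_def)
    have "GH_distance X Y = 0 \<longleftrightarrow> isometric X Y"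
      using isometric_imp_GH_distance_zero[OF XY(1)] GH_distance_zero_imp_isometric[OF XY(3,4)]
      by blast
    then show "real_of_ereal (GH_distance X Y) = 0 \<longleftrightarrow> isometric_finite X Y"
      using GH_distance_finite[OF XY] XY by (auto simp: isometric_finite_def real_of_ereal_eq_0)
  qed
  show "dist x y \<le> dist x z + dist y z"
  proof transfer
    fix X Y W :: "nat metric"
    assume "isometric_finite X X" "isometric_finite Y Y" "isometric_finite W W"
    then have XYW: "mspace X \<noteq> {}" "mspace Y \<noteq> {}" "mspace W \<noteq> {}"
      "finite (mspace X)" "finite (mspace Y)" "finite (mspace W)"
      by (auto simp: isometric_finite_def)
    have "GH_distance X Y \<le> GH_distance X W + GH_distance Y W"
      using GH_distance_triangle[of X W Y] GH_distance_commute[of Y W] XYW by simp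
    moreover have "\<bar>GH_distance X Y\<bar> \<noteq> \<infinity>" "\<bar>GH_distance X W\<bar> \<noteq> \<infinity>" "\<bar>GH_distance Y W\<bar> \<noteq> \<infinity>"
      using XYW by (intro GH_distance_finite; simp)+
    ultimately show "real_of_ereal (GH_distance X Y) \<le>
        real_of_ereal (GH_distance X W) + real_of_ereal (GH_distance Y W)"
      by (cases "GH_distance X Y"; cases "GH_distance X W"; cases "GH_distance Y W") auto
  qed
qed (rule uniformity_finite_metric_class_def open_finite_metric_class_def)+

end

section \<open>Coarse embeddings and uniform convexity\<close>

definition coarse_embedding :: "('a::metric_space \<Rightarrow> 'b::metric_space) \<Rightarrow> bool" where
  "coarse_embedding \<psi> \<longleftrightarrow>
     (\<exists>\<rho>m \<rho>p :: real \<Rightarrow> real.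
        (\<forall>t\<ge>0. 0 \<le> \<rho>m t \<and> 0 \<le> \<rho>p t) \<and> filterlim \<rho>m at_top at_top \<and>
        (\<forall>x y. \<rho>m (dist x y) \<le> dist (\<psi> x) (\<psi> y) \<and> dist (\<psi> x) (\<psi> y) \<le> \<rho>p (dist x y)))"

definition uniformly_convex :: "'a::banach itself \<Rightarrow> bool" where
  "uniformly_convex _ \<longleftrightarrow>
     (\<forall>\<epsilon>. 0 < \<epsilon> \<and> \<epsilon> \<le> 2 \<longrightarrow>
        (\<exists>\<delta>>0. \<forall>x y :: 'a. norm x = 1 \<longrightarrow> norm y = 1 \<longrightarrow> norm (x - y) \<ge> \<epsilon> \<longrightarrow>
           norm ((1 / 2) *\<^sub>R (x + y)) \<le> 1 - \<delta>))"

end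

theory Submission
  imports Defs
begin

text \<open>Kalton's interlacing graphs on the increasing \<open>k\<close>-tuples of natural numbers are realised by finite
  ultrametric spaces: the tuple \<open>l\<close> becomes the set of numbers bounded by some entry of \<open>l\<close>, two
  distinct points being at distance the larger of their heights, where the height of \<open>i\<close> is the
  number of entries of \<open>l\<close> that are at least \<open>i\<close>. Interlaced tuples change heights by at most one,
  so their spaces have Gromov-Hausdorff distance at most 1; if all entries of \<open>l\<close> precede those of \<open>r\<close>,
  then the second space has more points at height \<open>k\<close> than the first has points, and the distance is
  of order \<open>k\<close>. On the other hand, in a uniformly convex space iterated limits of \<open>\<phi>\<^sub>i (x\<^sub>j)\<close>, for
  functionals of norm at most 1 and bounded vectors, can be exchanged (otherwise dyadic averages
  would form a separated bounded tree), and this forces every bounded map on tuples that moves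
  interlaced tuples by at most \<open>L\<close> to map some far apart tuples to points at distance at most \<open>2 L + 1\<close>.\<close>

section \<open>Limit functionals\<close>

text \<open>An abstract ultrafilter limit of bounded families: finitely many of them come close to their
  limits at a common index. Linearity is a consequence.\<close>
definition limit_functional :: "'i set \<Rightarrow> (('i \<Rightarrow> real) \<Rightarrow> real) \<Rightarrow> bool" where
  "limit_functional S \<Lambda> \<longleftrightarrow>
     (\<forall>F \<epsilon>. finite F \<longrightarrow> (\<forall>f\<in>F. bounded (range f)) \<longrightarrow> 0 < \<epsilon> \<longrightarrow>
        (\<exists>i\<in>S. \<forall>f\<in>F. \<bar>f i - \<Lambda> f\<bar> < \<epsilon>))"

lemma limit_functionalE:
  assumes "limit_functional S \<Lambda>" "finite F" "\<And>f. f \<in> F \<Longrightarrow> bounded (range f)" "0 < \<epsilon>"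
  obtains i where "i \<in> S" "\<And>f. f \<in> F \<Longrightarrow> \<bar>f i - \<Lambda> f\<bar> < \<epsilon>"
  using assms unfolding limit_functional_def by meson

lemma limit_functional_witness:
  assumes "limit_functional S \<Lambda>" "bounded (range f)" "0 < \<epsilon>"
  obtains i where "i \<in> S" "\<bar>f i - \<Lambda> f\<bar> < \<epsilon>"
  using limit_functionalE[OF assms(1), of "{f}" \<epsilon>] assms(2,3) by blast

lemma limit_functional_mono: "limit_functional S \<Lambda> \<Longrightarrow> S \<subseteq> T \<Longrightarrow> limit_functional T \<Lambda>"
  unfolding limit_functional_def by (meson subsetD)

lemma bounded_range_abs: "bounded (range f) \<longleftrightarrow> (\<exists>B. \<forall>i. \<bar>f i :: real\<bar> \<le> B)"
  by (auto simp: bounded_iff)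

lemma limit_functional_bound:
  assumes \<Lambda>: "limit_functional S \<Lambda>" and B: "\<And>i. \<bar>f i\<bar> \<le> B"
  shows "\<bar>\<Lambda> f\<bar> \<le> B"
proof (rule field_le_epsilon)
  fix e :: real assume "e > 0"
  moreover have "bounded (range f)" using B by (auto simp: bounded_range_abs)
  ultimately obtain i where "\<bar>f i - \<Lambda> f\<bar> < e"
    using limit_functionalE[OF \<Lambda>, of "{f}" e] by auto
  with B[of i] show "\<bar>\<Lambda> f\<bar> \<le> B + e" by linarith
qed

text \<open>One index brings \<open>f\<close>, \<open>g\<close> and their sum close to their limits
  at once, so additivity at that index passes to \<open>\<Lambda>\<close>.\<close>

lemma limit_functional_add:
  assumes \<Lambda>: "limit_functional S \<Lambda>" and f: "bounded (range f)" and g: "bounded (range g)"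
  shows "\<Lambda> (\<lambda>i. f i + g i) = \<Lambda> f + \<Lambda> g"
proof -
  have fg: "bounded (range (\<lambda>i. f i + g i))" using f g by (rule bounded_plus_comp)
  have "\<bar>\<Lambda> (\<lambda>i. f i + g i) - (\<Lambda> f + \<Lambda> g)\<bar> \<le> 0 + e" if "e > 0" for e
  proof -
    have "e / 3 > 0" using that by simp
    then obtain i where i: "\<And>h. h \<in> {f, g, \<lambda>i. f i + g i} \<Longrightarrow> \<bar>h i - \<Lambda> h\<bar> < e / 3"
      by (rule_tac limit_functionalE[OF \<Lambda>, of "{f, g, \<lambda>i. f i + g i}" "e / 3"])
        (use f g fg in auto)
    have "\<bar>f i - \<Lambda> f\<bar> < e / 3" "\<bar>g i - \<Lambda> g\<bar> < e / 3"
      "\<bar>f i + g i - \<Lambda> (\<lambda>i. f i + g i)\<bar> < e / 3"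
      using i by auto
    then show ?thesis by linarith
  qed
  then have "\<bar>\<Lambda> (\<lambda>i. f i + g i) - (\<Lambda> f + \<Lambda> g)\<bar> \<le> 0" by (rule field_le_epsilon)
  then show ?thesis by simp
qed

lemma limit_functional_scale:
  assumes \<Lambda>: "limit_functional S \<Lambda>" and f: "bounded (range f)"
  shows "\<Lambda> (\<lambda>i. c * f i) = c * \<Lambda> f"
proof -
  have cf: "bounded (range (\<lambda>i. c * f i))"
    using bounded_scaling[OF f, of c] by (simp add: image_image)
  have "\<bar>\<Lambda> (\<lambda>i. c * f i) - c * \<Lambda> f\<bar> \<le> 0 + e" if "e > 0" for e
  proof -
    \<comment> \<open>An error \<open>d\<close> for the scaled family and
      \<open>\<bar>c\<bar> * d\<close> for the scaled error of \<open>f\<close> add up to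
      \<open>e\<close>.\<close>
    define d where "d = e / (1 + \<bar>c\<bar>)"
    have d: "d > 0" "d + \<bar>c\<bar> * d = e"
      using that by (auto simp: d_def add_divide_distrib[symmetric] add_nonneg_eq_0_iff
        divide_eq_eq distrib_left mult.commute)
    obtain i where i: "\<And>h. h \<in> {f, \<lambda>i. c * f i} \<Longrightarrow> \<bar>h i - \<Lambda> h\<bar> < d"
      by (rule limit_functionalE[OF \<Lambda>, of "{f, \<lambda>i. c * f i}" d]) (use f cf d in auto)
    have "\<bar>c * (f i - \<Lambda> f)\<bar> \<le> \<bar>c\<bar> * d"
      unfolding abs_mult using i[of f] by (intro mult_left_mono) auto
    then have "\<bar>c * f i - c * \<Lambda> f\<bar> \<le> \<bar>c\<bar> * d" by (simp add: right_diff_distrib)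
    moreover have "\<bar>c * f i - \<Lambda> (\<lambda>i. c * f i)\<bar> < d" using i[of "\<lambda>i. c * f i"] by simp
    ultimately show ?thesis using d by linarith
  qed
  then have "\<bar>\<Lambda> (\<lambda>i. c * f i) - c * \<Lambda> f\<bar> \<le> 0" by (rule field_le_epsilon)
  then show ?thesis by simp
qed

lemma limit_functional_diff:
  assumes \<Lambda>: "limit_functional S \<Lambda>" and f: "bounded (range f)" and g: "bounded (range g)"
  shows "\<Lambda> (\<lambda>i. f i - g i) = \<Lambda> f - \<Lambda> g"
proof -
  have "bounded (range (\<lambda>i. - 1 * g i))"
    using bounded_scaling[OF g, of "-1"] by (simp add: image_image)
  from limit_functional_add[OF \<Lambda> f this] limit_functional_scale[OF \<Lambda> g, of "-1"]
  show ?thesis by simp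
qed

lemma limit_functional_const:
  assumes "limit_functional S \<Lambda>" shows "\<Lambda> (\<lambda>_. c) = c"
proof -
  have "\<Lambda> (\<lambda>_. 1) = 1"
  proof -
    have "\<bar>1 - \<Lambda> (\<lambda>_. 1)\<bar> \<le> 0 + e" if "e > 0" for e
      using limit_functionalE[OF assms, of "{\<lambda>_. 1}" e] that by force
    then have "\<bar>1 - \<Lambda> (\<lambda>_. 1)\<bar> \<le> 0" by (rule field_le_epsilon)
    then show ?thesis by simp
  qed
  with limit_functional_scale[OF assms, of "\<lambda>_. 1" c] show ?thesis by simp
qed

section \<open>Pushforwards, products and existence of limit functionals\<close>

lemma limit_functional_image:
  assumes \<Lambda>: "limit_functional S \<Lambda>"
  shows "limit_functional (h ` S) (\<lambda>f. \<Lambda> (\<lambda>i. f (h i)))"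
  unfolding limit_functional_def
proof (intro allI impI)
  fix F :: "('b \<Rightarrow> real) set" and \<epsilon> :: real
  assume F: "finite F" "\<forall>f\<in>F. bounded (range f)" and \<epsilon>: "0 < \<epsilon>"
  have "bounded (range (\<lambda>i. f (h i)))" if "f \<in> F" for f
    using F(2) that unfolding bounded_range_abs by blast
  then obtain i where "i \<in> S" "\<And>g. g \<in> (\<lambda>f i. f (h i)) ` F \<Longrightarrow> \<bar>g i - \<Lambda> g\<bar> < \<epsilon>"
    by (rule_tac limit_functionalE[OF \<Lambda>, of "(\<lambda>f i. f (h i)) ` F" \<epsilon>]) (use F \<epsilon> in auto)
  then show "\<exists>i\<in>h ` S. \<forall>f\<in>F. \<bar>f i - \<Lambda> (\<lambda>i. f (h i))\<bar> < \<epsilon>" by blast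
qed

text \<open>First \<open>i\<close> is chosen for the finitely many inner limits, then
  \<open>j\<close> for the sections at this \<open>i\<close>. Since \<open>T\<close> may depend on
  \<open>i\<close>, later entries of a tuple can be kept above earlier ones.\<close>

lemma limit_functional_Sigma:
  assumes \<Lambda>: "limit_functional S \<Lambda>" and M: "\<And>i. i \<in> S \<Longrightarrow> limit_functional (T i) M"
  shows "limit_functional (Sigma S T) (\<lambda>F. \<Lambda> (\<lambda>i. M (\<lambda>j. F (i, j))))"
  unfolding limit_functional_def
proof (intro allI impI)
  fix F :: "('a \<times> 'b \<Rightarrow> real) set" and \<epsilon> :: real
  assume F: "finite F" "\<forall>f\<in>F. bounded (range f)" and \<epsilon>: "0 < \<epsilon>"
  obtain i0 where "i0 \<in> S" using limit_functionalE[OF \<Lambda>, of "{}" 1] by auto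
  then have MT: "limit_functional (T i0) M" by (rule M)
  have bd: "bounded (range (\<lambda>i. M (\<lambda>j. f (i, j))))" if "f \<in> F" for f
    using F(2) that limit_functional_bound[OF MT] unfolding bounded_range_abs by meson
  obtain i where i: "i \<in> S"
    "\<And>g. g \<in> (\<lambda>f i. M (\<lambda>j. f (i, j))) ` F \<Longrightarrow> \<bar>g i - \<Lambda> g\<bar> < \<epsilon> / 2"
    by (rule limit_functionalE[OF \<Lambda>, of "(\<lambda>f i. M (\<lambda>j. f (i, j))) ` F" "\<epsilon> / 2"])
      (use F \<epsilon> bd in auto)
  have bd': "bounded (range (\<lambda>j. f (i, j)))" if "f \<in> F" for f
    using F(2) that unfolding bounded_range_abs by blast
  obtain j where j: "j \<in> T i"
    "\<And>g. g \<in> (\<lambda>f j. f (i, j)) ` F \<Longrightarrow> \<bar>g j - M g\<bar> < \<epsilon> / 2"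
    by (rule limit_functionalE[OF M[OF i(1)], of "(\<lambda>f j. f (i, j)) ` F" "\<epsilon> / 2"])
      (use F \<epsilon> bd' in auto)
  have "\<bar>f (i, j) - \<Lambda> (\<lambda>i. M (\<lambda>j. f (i, j)))\<bar> < \<epsilon>" if "f \<in> F" for f
  proof -
    have "\<bar>M (\<lambda>j. f (i, j)) - \<Lambda> (\<lambda>i. M (\<lambda>j. f (i, j)))\<bar> < \<epsilon> / 2" using that by (intro i(2)) auto
    moreover have "\<bar>f (i, j) - M (\<lambda>j. f (i, j))\<bar> < \<epsilon> / 2" using that by (intro j(2)) auto
    ultimately show ?thesis by linarith
  qed
  then show "\<exists>p\<in>Sigma S T. \<forall>f\<in>F. \<bar>f p - \<Lambda> (\<lambda>i. M (\<lambda>j. f (i, j)))\<bar> < \<epsilon>"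
    using i(1) j(1) by blast
qed

text \<open>By Tychonov's theorem, the evaluations at \<open>n\<close> have a cluster point in a product of intervals.\<close>
lemma limit_functional_exists: "\<exists>U. \<forall>N::nat. limit_functional {N<..} U"
proof -
  define B :: "(nat \<Rightarrow> real) \<Rightarrow> real" where
    "B f = (if bounded (range f) then SOME B. \<forall>i. \<bar>f i\<bar> \<le> B else 0)" for f
  have B: "\<bar>f i\<bar> \<le> B f" if "bounded (range f)" for f i
    using that someI_ex[of "\<lambda>B. \<forall>i. \<bar>f i\<bar> \<le> B"] by (auto simp: B_def bounded_range_abs)
  \<comment> \<open>Unbounded families get the value 0 and, through \<open>B\<close>, the interval
    {0}, so that every evaluation lies in the compact product \<open>K\<close>.\<close>
  define ev where "ev n = (\<lambda>f :: nat \<Rightarrow> real. if bounded (range f) then f n else 0)" for n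
  define K where "K = PiE UNIV (\<lambda>f. cball (0::real) (B f))"
  have "compactin (product_topology (\<lambda>_. euclidean) UNIV) K"
    unfolding K_def compactin_PiE by (simp add: compact_cball)
  then have K: "compact K" by (simp add: euclidean_product_topology)
  have ev: "ev n \<in> K" for n
    using B by (auto simp: K_def ev_def B_def)
  have "\<forall>\<^sub>F \<Lambda> in filtermap ev sequentially. \<Lambda> \<in> K"
    using ev by (auto simp: eventually_filtermap)
  moreover have "filtermap ev sequentially \<noteq> bot" by (simp add: filtermap_bot_iff)
  \<comment> \<open>\<open>U\<close> is a cluster point of the evaluations along all tails, so the
    same \<open>U\<close> serves every \<open>N\<close>.\<close>
  ultimately obtain U where U: "inf (nhds U) (filtermap ev sequentially) \<noteq> bot"
    using K unfolding compact_filter le_principal by blast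
  have "limit_functional {N<..} U" for N
    unfolding limit_functional_def
  proof (intro allI impI)
    fix F :: "(nat \<Rightarrow> real) set" and \<epsilon> :: real
    assume F: "finite F" "\<forall>f\<in>F. bounded (range f)" and \<epsilon>: "0 < \<epsilon>"
    define W where "W = {\<Lambda>. \<forall>f\<in>F. \<bar>\<Lambda> f - U f\<bar> < \<epsilon>}"
    have "W = (\<Inter>f\<in>F. (\<lambda>\<Lambda>. \<Lambda> f) -` ball (U f) \<epsilon>)" by (auto simp: W_def dist_real_def abs_minus_commute)
    also have "open \<dots>"
      using F(1) by (intro open_INT ballI open_vimage) (auto intro: continuous_intros)
    finally have "eventually (\<lambda>\<Lambda>. \<Lambda> \<in> W) (nhds U)"
      using \<epsilon> by (intro eventually_nhds_in_open) (auto simp: W_def)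
    then have 1: "eventually (\<lambda>\<Lambda>. \<Lambda> \<in> W) (inf (nhds U) (filtermap ev sequentially))"
      by (rule filter_leD[OF inf_le1])
    have "eventually (\<lambda>\<Lambda>. \<Lambda> \<in> ev ` {N<..}) (filtermap ev sequentially)"
      unfolding eventually_filtermap by (rule eventually_mono[OF eventually_gt_at_top[of N]]) auto
    then have 2: "eventually (\<lambda>\<Lambda>. \<Lambda> \<in> ev ` {N<..}) (inf (nhds U) (filtermap ev sequentially))"
      by (rule filter_leD[OF inf_le2])
    obtain n where "ev n \<in> W" "n \<in> {N<..}"
      using eventually_happens'[OF U eventually_conj[OF 1 2]] by blast
    then show "\<exists>i\<in>{N<..}. \<forall>f\<in>F. \<bar>f i - U f\<bar> < \<epsilon>"
      using F(2) unfolding W_def ev_def by (intro bexI[of _ n]) auto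
  qed
  then show ?thesis by blast
qed

section \<open>Norming functionals\<close>

definition sublinear :: "('a::real_vector \<Rightarrow> real) \<Rightarrow> bool" where
  "sublinear q \<longleftrightarrow> (\<forall>x y. q (x + y) \<le> q x + q y) \<and> (\<forall>c x. c \<ge> 0 \<longrightarrow> q (c *\<^sub>R x) = c * q x)"

lemma sublinearD:
  assumes "sublinear q"
  shows "q (x + y) \<le> q x + q y" "c \<ge> 0 \<Longrightarrow> q (c *\<^sub>R x) = c * q x" "q 0 = 0" "- q (- x) \<le> q x"
proof -
  show add: "q (x + y) \<le> q x + q y" for x y using assms by (simp add: sublinear_def)
  show "q (c *\<^sub>R x) = c * q x" if "c \<ge> 0" for c x using assms that by (simp add: sublinear_def)
  from this[of 0 0] show "q 0 = 0" by simp
  with add[of x "- x"] show "- q (- x) \<le> q x" by simp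
qed

text \<open>Hahn-Banach step: \<open>q\<close> is lowered along \<open>y\<close> by an infimum over
  t \<ge> 0 of q (x + t y) - t q y, and t = 1 gives the bound at \<open>- y\<close>. This makes
  minimal functionals odd and prepares the attainment of the norm.\<close>

lemma sublinear_linearize:
  assumes q: "sublinear q"
  obtains q' where "sublinear q'" "q' \<le> q" "q' (- y) \<le> - q y"
proof -
  define h where "h x t = q (x + t *\<^sub>R y) - t * q y" for x t
  define q' where "q' x = (INF t\<in>{0..}. h x t)" for x
  have bdd: "bdd_below (h x ` {0..})" for x
  proof (rule bdd_belowI2[of _ "- q (- x)"])
    fix t :: real assume "t \<in> {0..}"
    then show "- q (- x) \<le> h x t"
      using sublinearD(1)[OF q, of "x + t *\<^sub>R y" "- x"] sublinearD(2)[OF q, of t y]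
      by (simp add: h_def)
  qed
  have le: "q' x \<le> h x t" if "t \<ge> 0" for x t
    unfolding q'_def by (rule cINF_lower[OF bdd]) (use that in simp)
  have ge: "s \<le> q' x" if "\<And>t. t \<ge> 0 \<Longrightarrow> s \<le> h x t" for s x
    unfolding q'_def by (rule cINF_greatest) (use that in auto)
  have "sublinear q'"
    unfolding sublinear_def
  proof (intro conjI allI impI)
    fix x z
    have "q' (x + z) - h x s \<le> q' z" if s: "s \<ge> 0" for s
    proof (rule ge)
      fix t :: real assume t: "t \<ge> 0"
      have "q' (x + z) \<le> h (x + z) (s + t)" using s t by (intro le) auto
      also have "\<dots> \<le> h x s + h z t"
        using sublinearD(1)[OF q, of "x + s *\<^sub>R y" "z + t *\<^sub>R y"]
        by (simp add: h_def algebra_simps)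
      finally show "q' (x + z) - h x s \<le> h z t" by simp
    qed
    then have "q' (x + z) - q' z \<le> q' x" by (intro ge) (simp add: algebra_simps)
    then show "q' (x + z) \<le> q' x + q' z" by simp
  next
    fix c :: real and x assume c: "c \<ge> 0"
    show "q' (c *\<^sub>R x) = c * q' x"
    proof (cases "c = 0")
      case True
      have "q' 0 \<le> 0" using le[of 0 0] sublinearD(3)[OF q] by (simp add: h_def)
      moreover have "0 \<le> q' 0"
        by (rule ge) (simp add: h_def sublinearD(2)[OF q])
      ultimately show ?thesis using True by simp
    next
      case False
      with c have c: "c > 0" by simp
      have hc: "h (c *\<^sub>R x) (c * t) = c * h x t" for x t
        using sublinearD(2)[OF q, of c "x + t *\<^sub>R y"] c by (simp add: h_def algebra_simps)
      have "q' (c *\<^sub>R x) / c \<le> q' x"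
        by (rule ge) (use c le[of "c * _" "c *\<^sub>R x"] in \<open>simp add: field_simps flip: hc\<close>)
      moreover have "c * q' x \<le> q' (c *\<^sub>R x)"
      proof (rule ge)
        fix t :: real assume "t \<ge> 0"
        then have "c * q' x \<le> c * h x (t / c)" using c le[of "t / c" x] by simp
        then show "c * q' x \<le> h (c *\<^sub>R x) t" using c by (simp flip: hc)
      qed
      ultimately show ?thesis using c by (simp add: field_simps)
    qed
  qed
  moreover have "q' \<le> q" using le[of 0] by (auto simp: le_fun_def h_def)
  moreover have "q' (- y) \<le> - q y" using le[of 1 "- y"] sublinearD(3)[OF q] by (simp add: h_def)
  ultimately show ?thesis by (rule that)
qed

text \<open>Zorn's lemma for the reversed order. The infimum of a chain is finite, being bounded
  below by \<open>- p (- x)\<close>, and subadditive, because two members of a chain have a common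
  lower member.\<close>

lemma sublinear_minimal_exists:
  assumes p: "sublinear p"
  obtains q where "sublinear q" "q \<le> p" "\<And>r. sublinear r \<Longrightarrow> r \<le> q \<Longrightarrow> r = q"
proof -
  define A where "A = {q. sublinear q \<and> q \<le> p}"
  have "\<exists>m\<in>A. \<forall>a\<in>A. m \<ge> a \<longrightarrow> a = m"
  proof (rule predicate_Zorn)
    show "partial_order_on A (relation_of (\<ge>) A)"
      by (auto simp: partial_order_on_def preorder_on_def refl_on_def trans_def antisym_def relation_of_def)
    fix C assume C: "C \<in> Chains (relation_of (\<ge>) A)"
    show "\<exists>u\<in>A. \<forall>a\<in>C. u \<le> a"
    proof (cases "C = {}")
      case True
      then show ?thesis using p by (auto simp: A_def)
    next
      case False
      have CA: "sublinear q" "q \<le> p" if "q \<in> C" for q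
        using C that by (auto simp: Chains_def relation_of_def A_def)
      have tot: "q \<le> r \<or> r \<le> q" if "q \<in> C" "r \<in> C" for q r
        using C that by (auto simp: Chains_def relation_of_def)
      define u where "u x = (INF q\<in>C. q x)" for x
      have bdd: "bdd_below ((\<lambda>q. q x) ` C)" for x
      proof (rule bdd_belowI2[of _ "- p (- x)"])
        fix q assume q: "q \<in> C"
        show "- p (- x) \<le> q x"
          using sublinearD(4)[OF CA(1)[OF q], of x] le_funD[OF CA(2)[OF q], of "- x"] by simp
      qed
      have le: "u x \<le> q x" if "q \<in> C" for x q
        unfolding u_def by (rule cINF_lower[OF bdd that])
      have ge: "s \<le> u x" if "\<And>q. q \<in> C \<Longrightarrow> s \<le> q x" for s x
        unfolding u_def by (rule cINF_greatest[OF False that])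
      have "sublinear u"
        unfolding sublinear_def
      proof (intro conjI allI impI)
        fix x z
        have "u (x + z) - q x \<le> u z" if q: "q \<in> C" for q
        proof (rule ge)
          fix r assume r: "r \<in> C"
          obtain s where s: "s \<in> C" "s \<le> q" "s \<le> r" using tot[OF q r] q r by blast
          have "u (x + z) \<le> s (x + z)" by (rule le[OF s(1)])
          also have "\<dots> \<le> s x + s z" by (rule sublinearD(1)[OF CA(1)[OF s(1)]])
          finally show "u (x + z) - q x \<le> r z"
            using le_funD[OF s(2), of x] le_funD[OF s(3), of z] by linarith
        qed
        then have "u (x + z) - u z \<le> u x" by (intro ge) (simp add: algebra_simps)
        then show "u (x + z) \<le> u x + u z" by simp
      next
        fix c :: real and x assume c: "c \<ge> 0"
        have eq: "q (c *\<^sub>R x) = c * q x" if "q \<in> C" for q using sublinearD(2)[OF CA(1)[OF that] c] .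
        show "u (c *\<^sub>R x) = c * u x"
        proof (cases "c = 0")
          case True
          have "(\<lambda>q. q 0) ` C = {0}" using False sublinearD(3)[OF CA(1)] by force
          then show ?thesis using True by (simp add: u_def)
        next
          case nz: False
          with c have c: "c > 0" by simp
          have "u (c *\<^sub>R x) / c \<le> u x"
            by (rule ge) (use c le[of _ "c *\<^sub>R x"] in \<open>simp add: field_simps eq flip: eq\<close>)
          moreover have "c * u x \<le> u (c *\<^sub>R x)"
            by (rule ge) (use c le[of _ x] in \<open>simp add: eq\<close>)
          ultimately show ?thesis using c by (simp add: field_simps)
        qed
      qed
      moreover have "u \<le> p" using False le CA(2) by (meson all_not_in_conv le_fun_def order_trans)
      ultimately show ?thesis using le by (auto simp: A_def le_fun_def)
    qed
  qed
  then obtain m where "m \<in> A" "\<forall>a\<in>A. a \<le> m \<longrightarrow> a = m" by blast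
  then show ?thesis by (intro that[of m]) (auto simp: A_def)
qed

text \<open>A minimal \<open>q\<close> equals its own lowering along \<open>y\<close> and is
  therefore odd; subadditivity at \<open>- x\<close> and \<open>- y\<close> then gives the reverse
  inequality.\<close>

lemma sublinear_minimal_linear:
  assumes q: "sublinear q" and min: "\<And>r. sublinear r \<Longrightarrow> r \<le> q \<Longrightarrow> r = q"
  shows "linear q"
proof -
  have neg: "q (- y) = - q y" for y
  proof (rule antisym)
    obtain r where "sublinear r" "r \<le> q" "r (- y) \<le> - q y" using sublinear_linearize[OF q] .
    then show "q (- y) \<le> - q y" using min by metis
    show "- q y \<le> q (- y)" using sublinearD(4)[OF q, of y] by simp
  qed
  show ?thesis
  proof (rule linearI)
    show "q (x + y) = q x + q y" for x y
      using sublinearD(1)[OF q, of x y] sublinearD(1)[OF q, of "- x" "- y"] neg[of "x + y"] neg[of x] neg[of y]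
      by simp
    show "q (c *\<^sub>R x) = c *\<^sub>R q x" for c x
      using sublinearD(2)[OF q, of c x] sublinearD(2)[OF q, of "- c" x] neg[of "c *\<^sub>R x"]
      by (cases "c \<ge> 0") auto
  qed
qed

text \<open>Lowering the norm along \<open>v\<close> first forces every linear functional below the
  result to attain the norm at \<open>v\<close>.\<close>

lemma norming_functional:
  fixes v :: "'a::real_normed_vector"
  obtains \<phi> :: "'a \<Rightarrow> real" where "linear \<phi>" "\<And>x. \<bar>\<phi> x\<bar> \<le> norm x" "\<phi> v = norm v"
proof -
  have "sublinear (norm :: 'a \<Rightarrow> real)" by (simp add: sublinear_def norm_triangle_ineq)
  then obtain p where p: "sublinear p" "p \<le> norm" "p (- v) \<le> - norm v"
    by (rule sublinear_linearize)
  obtain \<phi> where \<phi>: "sublinear \<phi>" "\<phi> \<le> p" "\<And>r. sublinear r \<Longrightarrow> r \<le> \<phi> \<Longrightarrow> r = \<phi>"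
    by (rule sublinear_minimal_exists[OF p(1)]) blast
  have lin: "linear \<phi>" using \<phi>(1,3) by (rule sublinear_minimal_linear)
  have le: "\<phi> x \<le> norm x" for x using \<phi>(2) p(2) by (meson le_funD order_trans)
  have neg: "\<phi> (- x) = - \<phi> x" for x using linear_neg[OF lin] .
  have "\<phi> v = norm v"
    using le[of v] le_funD[OF \<phi>(2), of "- v"] p(3) neg[of v] by simp
  moreover have "\<bar>\<phi> x\<bar> \<le> norm x" for x using le[of x] le[of "- x"] neg[of x] by simp
  ultimately show ?thesis using lin that by blast
qed

section \<open>Exchanging limits in uniformly convex spaces\<close>

text \<open>If one vector is short, the triangle inequality suffices; otherwise both are close to
  the sphere, and their normalisations are still \<epsilon> / 2 apart.\<close>

lemma uniformly_convex_ball: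
  assumes uc: "uniformly_convex TYPE('a::banach)" and \<epsilon>: "0 < \<epsilon>" "\<epsilon> \<le> 2"
  obtains \<delta> where "0 < \<delta>" "\<delta> < 1"
    "\<And>r (x::'a) y. 0 < r \<Longrightarrow> norm x \<le> r \<Longrightarrow> norm y \<le> r \<Longrightarrow> \<epsilon> * r \<le> norm (x - y) \<Longrightarrow>
        norm ((1 / 2) *\<^sub>R (x + y)) \<le> (1 - \<delta>) * r"
proof -
  have "0 < \<epsilon> / 2 \<and> \<epsilon> / 2 \<le> 2" using \<epsilon> by simp
  then obtain d where d: "d > 0"
    and uc': "\<And>x y :: 'a. norm x = 1 \<Longrightarrow> norm y = 1 \<Longrightarrow> \<epsilon> / 2 \<le> norm (x - y) \<Longrightarrow>
        norm ((1 / 2) *\<^sub>R (x + y)) \<le> 1 - d"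
    using uc unfolding uniformly_convex_def by meson
  \<comment> \<open>\<epsilon> / 8 serves when the shorter vector has norm at most 1 - \<epsilon> /
    4. Otherwise its norm is at least 1 / 2, which leaves half of the gain \<open>d\<close>.\<close>
  define \<delta> where "\<delta> = min (\<epsilon> / 8) (d / 2)"
  have \<delta>: "0 < \<delta>" "\<delta> < 1" "\<delta> \<le> \<epsilon> / 8" "\<delta> \<le> d / 2" using d \<epsilon> by (auto simp: \<delta>_def)
  have ordered: "norm (x + y) \<le> 2 * (1 - \<delta>)"
    if x: "norm x \<le> 1" and y: "norm y \<le> norm x" and xy: "\<epsilon> \<le> norm (x - y)" for x y :: 'a
  proof (cases "norm y \<le> 1 - \<epsilon> / 4")
    case True
    with norm_triangle_ineq[of x y] x \<delta> show ?thesis by simp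
  next
    case False
    with x y have n: "norm x > 1 - \<epsilon> / 4" "norm y > 1 - \<epsilon> / 4" "norm y \<ge> 1 / 2" "norm x > 0" "norm y > 0"
      using \<epsilon> by auto
    define u where "u = (1 / norm x) *\<^sub>R x"
    define w where "w = (1 / norm y) *\<^sub>R y"
    have u: "norm u = 1" "x = norm x *\<^sub>R u" and w: "norm w = 1" "y = norm y *\<^sub>R w"
      using n by (auto simp: u_def w_def)
    have "x - u = (norm x - 1) *\<^sub>R u" "w - y = (1 - norm y) *\<^sub>R w"
      using u(2) w(2) by (simp_all add: scaleR_diff_left)
    then have "norm (x - u) \<le> \<epsilon> / 4" "norm (w - y) \<le> \<epsilon> / 4"
      using u w x y n by auto
    moreover have "x - y = (x - u) + ((u - w) + (w - y))" by simp
    then have "norm (x - y) \<le> norm (x - u) + (norm (u - w) + norm (w - y))"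
      by (metis norm_triangle_ineq norm_triangle_mono order_refl)
    ultimately have "\<epsilon> / 2 \<le> norm (u - w)" using xy by linarith
    from uc'[OF u(1) w(1) this] have "norm (u + w) \<le> 2 * (1 - d)" by simp
    then have "norm y * norm (u + w) \<le> norm y * (2 * (1 - d))" by (rule mult_left_mono) simp
    then have "norm y * norm (u + w) \<le> 2 * norm y - 2 * (norm y * d)" by (simp add: algebra_simps)
    moreover have "x + y = norm y *\<^sub>R (u + w) + (norm x - norm y) *\<^sub>R u"
      using u(2) w(2) by (simp add: scaleR_add_right scaleR_diff_left)
    then have "norm (x + y) \<le> norm y * norm (u + w) + (norm x - norm y)"
      using norm_triangle_ineq[of "norm y *\<^sub>R (u + w)" "(norm x - norm y) *\<^sub>R u"] u(1) y by simp
    moreover have "d / 2 \<le> norm y * d" using n(3) d mult_right_mono[of "1/2" "norm y" d] by simp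
    ultimately show ?thesis using x y \<delta>(4) by argo
  qed
  have unit: "norm (x + y) \<le> 2 * (1 - \<delta>)"
    if "norm x \<le> 1" "norm y \<le> 1" "\<epsilon> \<le> norm (x - y)" for x y :: 'a
    using ordered[of x y] ordered[of y x] that
    by (cases "norm y \<le> norm x") (auto simp: add.commute norm_minus_commute)
  show ?thesis
  proof (rule that[OF \<delta>(1,2)])
    fix r and x y :: 'a
    assume r: "0 < r" and xy: "norm x \<le> r" "norm y \<le> r" "\<epsilon> * r \<le> norm (x - y)"
    have "norm ((1 / r) *\<^sub>R x + (1 / r) *\<^sub>R y) \<le> 2 * (1 - \<delta>)"
    proof (rule unit)
      show "norm ((1 / r) *\<^sub>R x) \<le> 1" "norm ((1 / r) *\<^sub>R y) \<le> 1"
        using r xy by simp_all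
      have "norm ((1 / r) *\<^sub>R x - (1 / r) *\<^sub>R y) = norm (x - y) / r"
        using r by (simp flip: scaleR_diff_right)
      then show "\<epsilon> \<le> norm ((1 / r) *\<^sub>R x - (1 / r) *\<^sub>R y)"
        using r xy(3) by (simp only: pos_le_divide_eq)
    qed
    moreover have "norm ((1 / r) *\<^sub>R x + (1 / r) *\<^sub>R y) = norm (x + y) / r"
      using r by (simp flip: scaleR_add_right)
    ultimately have "norm (x + y) \<le> 2 * ((1 - \<delta>) * r)" using r by (simp add: field_simps)
    then show "norm ((1 / 2) *\<^sub>R (x + y)) \<le> (1 - \<delta>) * r" by simp
  qed
qed

text \<open>The average of \<open>2 ^ h\<close> consecutive terms, built from midpoints so that
  uniform convexity acts at every level.\<close>

primrec dyadic_mean :: "(nat \<Rightarrow> 'a::real_vector) \<Rightarrow> nat \<Rightarrow> nat \<Rightarrow> 'a" where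
  "dyadic_mean y 0 a = y a"
| "dyadic_mean y (Suc h) a = (1 / 2) *\<^sub>R (dyadic_mean y h a + dyadic_mean y h (a + 2 ^ h))"

lemma dyadic_mean_near:
  assumes \<phi>: "linear \<phi>" and near: "\<And>t. a \<le> t \<Longrightarrow> t < a + 2 ^ h \<Longrightarrow> \<bar>\<phi> (y t) - c\<bar> \<le> \<theta>"
  shows "\<bar>\<phi> (dyadic_mean y h a) - c :: real\<bar> \<le> \<theta>"
  using near
proof (induction h arbitrary: a)
  case (Suc h)
  have "\<bar>\<phi> (dyadic_mean y h a) - c\<bar> \<le> \<theta>" "\<bar>\<phi> (dyadic_mean y h (a + 2 ^ h)) - c\<bar> \<le> \<theta>"
    by (intro Suc.IH Suc.prems; simp)+
  moreover have "\<phi> (dyadic_mean y (Suc h) a) =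
      (\<phi> (dyadic_mean y h a) + \<phi> (dyadic_mean y h (a + 2 ^ h))) / 2"
    by (simp add: linear_add[OF \<phi>] linear_scale[OF \<phi>])
  ultimately show ?case by argo
qed auto

text \<open>James' tree argument: separated dyadic means shrink at every level, until they are too
  short to be separated.\<close>
lemma uniformly_convex_no_separated_sequence:
  fixes y :: "nat \<Rightarrow> 'a::banach"
  assumes uc: "uniformly_convex TYPE('a)" and B: "\<And>t. norm (y t) \<le> B"
    and lin: "\<And>s. linear (\<phi> s)" and norm: "\<And>s x. \<bar>\<phi> s x :: real\<bar> \<le> norm x"
    and \<theta>: "0 < \<theta>" "\<bar>\<alpha> - \<beta>\<bar> \<ge> 3 * \<theta>"
    and late: "\<And>s t. s \<le> t \<Longrightarrow> \<bar>\<phi> s (y t) - \<alpha>\<bar> \<le> \<theta>"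
    and early: "\<And>s t. t < s \<Longrightarrow> \<bar>\<phi> s (y t) - \<beta>\<bar> \<le> \<theta>"
  shows False
proof -
  let ?S = "dyadic_mean y"
  have sep: "\<theta> \<le> norm (?S h a - ?S h (a + 2 ^ h))" for h a
  proof -
    \<comment> \<open>The index \<open>a + 2 ^ h\<close> exceeds all indices of the left block and
      none of the right one, so its functional sees \<beta> on the left and \<alpha> on the
      right.\<close>
    have "\<bar>\<phi> (a + 2 ^ h) (?S h a) - \<beta>\<bar> \<le> \<theta>" by (rule dyadic_mean_near[OF lin early])
    moreover have "\<bar>\<phi> (a + 2 ^ h) (?S h (a + 2 ^ h)) - \<alpha>\<bar> \<le> \<theta>"
      by (rule dyadic_mean_near[OF lin late])
    ultimately have "\<theta> \<le> \<bar>\<phi> (a + 2 ^ h) (?S h a) - \<phi> (a + 2 ^ h) (?S h (a + 2 ^ h))\<bar>"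
      using \<theta> by linarith
    also have "\<dots> \<le> norm (?S h a - ?S h (a + 2 ^ h))"
      using norm[of "a + 2 ^ h" "?S h a - ?S h (a + 2 ^ h)"] by (simp add: linear_diff[OF lin])
    finally show ?thesis .
  qed
  \<comment> \<open>The maximum makes \<theta> / R at most 1, an admissible separation for the
    modulus.\<close>
  define R where "R = max B \<theta>"
  have R: "R > 0" "\<theta> \<le> R" "norm (y t) \<le> R" for t using B[of t] \<theta> by (auto simp: R_def)
  obtain \<delta> where \<delta>: "0 < \<delta>" "\<delta> < 1"
    and conv: "\<And>r (x::'a) y. 0 < r \<Longrightarrow> norm x \<le> r \<Longrightarrow> norm y \<le> r \<Longrightarrow> \<theta> / R * r \<le> norm (x - y) \<Longrightarrow>
        norm ((1 / 2) *\<^sub>R (x + y)) \<le> (1 - \<delta>) * r"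
    by (rule uniformly_convex_ball[OF uc, of "\<theta> / R"]) (use R \<theta> in \<open>auto simp: field_simps\<close>)
  have shrink: "norm (?S h a) \<le> (1 - \<delta>) ^ h * R" for h a
  proof (induction h arbitrary: a)
    case (Suc h)
    have "norm (?S (Suc h) a) \<le> (1 - \<delta>) * ((1 - \<delta>) ^ h * R)"
      unfolding dyadic_mean.simps
    proof (rule conv[OF _ Suc Suc])
      \<comment> \<open>The radius shrinks while the separation \<theta> stays, so one \<delta>
        serves all levels.\<close>
      have "(1 - \<delta>) ^ h \<le> 1" using \<delta> by (intro power_le_one) auto
      then have "\<theta> * (1 - \<delta>) ^ h \<le> \<theta>" using \<theta> by (simp add: mult_le_cancel_left1)
      then have "\<theta> / R * ((1 - \<delta>) ^ h * R) \<le> \<theta>" using R by simp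
      then show "\<theta> / R * ((1 - \<delta>) ^ h * R) \<le> norm (?S h a - ?S h (a + 2 ^ h))"
        using sep order_trans by blast
    qed (use \<delta> R in auto)
    then show ?case by (simp add: mult.assoc)
  qed (use R in auto)
  obtain h where "(1 - \<delta>) ^ h < \<theta> / (2 * R)"
    using real_arch_pow_inv[of "\<theta> / (2 * R)" "1 - \<delta>"] \<theta> R \<delta> by auto
  then have "2 * ((1 - \<delta>) ^ h * R) < \<theta>" using R by (simp add: field_simps)
  moreover have "norm (?S h 0 - ?S h (0 + 2 ^ h)) \<le> 2 * ((1 - \<delta>) ^ h * R)"
    using norm_triangle_ineq4[of "?S h 0" "?S h (0 + 2 ^ h)"] shrink[of h 0] shrink[of h "0 + 2 ^ h"]
    by linarith
  ultimately show False using sep[of h 0] by linarith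
qed

text \<open>Grothendieck's double limit criterion: if the limits differed, indices chosen in turn
  would give values near \<alpha> for s \<le> t and near \<beta> for t < s, as excluded
  above.\<close>

lemma double_limit:
  fixes x :: "'j \<Rightarrow> 'a::banach" and \<phi> :: "'i \<Rightarrow> 'a \<Rightarrow> real"
  assumes uc: "uniformly_convex TYPE('a)" and \<Lambda>: "limit_functional S \<Lambda>" and M: "limit_functional T M"
    and x: "\<And>j. norm (x j) \<le> B"
    and lin: "\<And>i. linear (\<phi> i)" and norm: "\<And>i x. \<bar>\<phi> i x\<bar> \<le> norm x"
  shows "\<Lambda> (\<lambda>i. M (\<lambda>j. \<phi> i (x j))) = M (\<lambda>j. \<Lambda> (\<lambda>i. \<phi> i (x j)))"
proof (rule ccontr)
  define \<alpha> where "\<alpha> = \<Lambda> (\<lambda>i. M (\<lambda>j. \<phi> i (x j)))"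
  define \<beta> where "\<beta> = M (\<lambda>j. \<Lambda> (\<lambda>i. \<phi> i (x j)))"
  define \<theta> where "\<theta> = \<bar>\<alpha> - \<beta>\<bar> / 3"
  assume "\<not> ?thesis"
  then have \<theta>: "\<theta> > 0" "\<theta> / 2 > 0" "\<bar>\<alpha> - \<beta>\<bar> \<ge> 3 * \<theta>" by (auto simp: \<theta>_def \<alpha>_def \<beta>_def)
  have le: "\<bar>\<phi> i (x j)\<bar> \<le> B" for i j using norm[of i "x j"] x[of j] by linarith
  have bd: "bounded (range (\<lambda>j. \<phi> i (x j)))" "bounded (range (\<lambda>i. \<phi> i (x j)))"
    "bounded (range (\<lambda>i. M (\<lambda>j. \<phi> i (x j))))" "bounded (range (\<lambda>j. \<Lambda> (\<lambda>i. \<phi> i (x j))))" for i j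
    unfolding bounded_range_abs using le limit_functional_bound[OF M] limit_functional_bound[OF \<Lambda>]
    by meson+
  \<comment> \<open>The demands on the pair of index \<open>s\<close>: its own limits are near
    \<alpha> and \<beta>, and it approximates the limits belonging to all earlier pairs.\<close>
  define P where "P f s p \<longleftrightarrow> (case p of (i, j) \<Rightarrow>
      \<bar>M (\<lambda>j. \<phi> i (x j)) - \<alpha>\<bar> < \<theta> / 2 \<and> \<bar>\<Lambda> (\<lambda>i. \<phi> i (x j)) - \<beta>\<bar> < \<theta> / 2 \<and>
      \<bar>\<phi> i (x j) - M (\<lambda>j. \<phi> i (x j))\<bar> < \<theta> / 2 \<and>
      (\<forall>t<s. \<bar>\<phi> i (x (snd (f t))) - \<Lambda> (\<lambda>i. \<phi> i (x (snd (f t))))\<bar> < \<theta> / 2 \<and>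
             \<bar>\<phi> (fst (f t)) (x j) - M (\<lambda>j. \<phi> (fst (f t)) (x j))\<bar> < \<theta> / 2))"
    for f :: "nat \<Rightarrow> 'i \<times> 'j" and s p
  have "\<exists>f. \<forall>s. P f s (f s)"
  proof (rule dependent_wf_choice[OF wf_less])
    show "P f s r = P g s r" if "\<And>t. (t, s) \<in> {(x, y). x < y} \<Longrightarrow> f t = g t" for f g s r
      using that by (simp add: P_def split: prod.split)
    show "\<exists>r. P f s r" for f s
    proof -
      let ?F = "insert (\<lambda>i. M (\<lambda>j. \<phi> i (x j))) ((\<lambda>t i. \<phi> i (x (snd (f t)))) ` {..<s})"
      obtain i where i: "\<And>g. g \<in> ?F \<Longrightarrow> \<bar>g i - \<Lambda> g\<bar> < \<theta> / 2"
        by (rule limit_functionalE[OF \<Lambda>, of ?F "\<theta> / 2"]) (use bd \<theta> in auto)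
      \<comment> \<open>\<open>j\<close> is chosen after \<open>i\<close> and can respect
        \<open>i\<close> itself; this puts the diagonal s = t on the side of \<alpha>.\<close>
      let ?G = "insert (\<lambda>j. \<Lambda> (\<lambda>i. \<phi> i (x j))) (insert (\<lambda>j. \<phi> i (x j))
          ((\<lambda>t j. \<phi> (fst (f t)) (x j)) ` {..<s}))"
      obtain j where j: "\<And>g. g \<in> ?G \<Longrightarrow> \<bar>g j - M g\<bar> < \<theta> / 2"
        by (rule limit_functionalE[OF M, of ?G "\<theta> / 2"]) (use bd \<theta> in auto)
      have "P f s (i, j)"
        unfolding P_def prod.case
      proof (intro conjI allI impI)
        show "\<bar>M (\<lambda>j. \<phi> i (x j)) - \<alpha>\<bar> < \<theta> / 2" unfolding \<alpha>_def by (rule i) simp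
        show "\<bar>\<Lambda> (\<lambda>i. \<phi> i (x j)) - \<beta>\<bar> < \<theta> / 2" unfolding \<beta>_def by (rule j) simp
        show "\<bar>\<phi> i (x j) - M (\<lambda>j. \<phi> i (x j))\<bar> < \<theta> / 2" by (rule j) simp
        show "\<bar>\<phi> i (x (snd (f t))) - \<Lambda> (\<lambda>i. \<phi> i (x (snd (f t))))\<bar> < \<theta> / 2" if "t < s" for t
          by (rule i) (use that in auto)
        show "\<bar>\<phi> (fst (f t)) (x j) - M (\<lambda>j. \<phi> (fst (f t)) (x j))\<bar> < \<theta> / 2" if "t < s" for t
          by (rule j) (use that in auto)
      qed
      then show ?thesis by blast
    qed
  qed
  then obtain f where f: "\<And>s. P f s (f s)" by blast
  define I where "I s = fst (f s)" for s
  define J where "J s = snd (f s)" for s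
  have eq: "f s = (I s, J s)" for s by (simp add: I_def J_def)
  note f' = f[unfolded P_def eq prod.case fst_conv snd_conv]
  show False
  proof (rule uniformly_convex_no_separated_sequence[where y = "\<lambda>t. x (J t)" and \<phi> = "\<lambda>s. \<phi> (I s)"])
    show "\<bar>\<phi> (I s) (x (J t)) - \<alpha>\<bar> \<le> \<theta>" if "s \<le> t" for s t
    proof -
      have "\<bar>\<phi> (I s) (x (J t)) - M (\<lambda>j. \<phi> (I s) (x j))\<bar> < \<theta> / 2"
        using that f'[of t] by (cases "s = t") auto
      then show ?thesis using f'[of s] by linarith
    qed
    show "\<bar>\<phi> (I s) (x (J t)) - \<beta>\<bar> \<le> \<theta>" if "t < s" for s t
    proof -
      have "\<bar>\<phi> (I s) (x (J t)) - \<Lambda> (\<lambda>i. \<phi> i (x (J t)))\<bar> < \<theta> / 2" using that f'[of s] by auto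
      then show ?thesis using f'[of t] by linarith
    qed
  qed (use uc x lin norm \<theta> in auto)
qed

section \<open>Concentration for interlaced tuples\<close>

text \<open>Allows averaged functionals to enter \<open>double_limit\<close> again.\<close>

lemma limit_functional_pointwise_linear:
  fixes \<phi> :: "'i \<Rightarrow> 'a::real_normed_vector \<Rightarrow> real"
  assumes \<Lambda>: "limit_functional S \<Lambda>" and lin: "\<And>i. linear (\<phi> i)" and norm: "\<And>i x. \<bar>\<phi> i x\<bar> \<le> norm x"
  shows "linear (\<lambda>x. \<Lambda> (\<lambda>i. \<phi> i x))" "\<bar>\<Lambda> (\<lambda>i. \<phi> i x)\<bar> \<le> norm x"
proof -
  have bd: "bounded (range (\<lambda>i. \<phi> i x))" for x unfolding bounded_range_abs using norm by blast
  show "linear (\<lambda>x. \<Lambda> (\<lambda>i. \<phi> i x))"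
    by (rule linearI)
      (simp_all add: linear_add[OF lin] linear_scale[OF lin] limit_functional_add[OF \<Lambda> bd bd]
        limit_functional_scale[OF \<Lambda> bd])
  show "\<bar>\<Lambda> (\<lambda>i. \<phi> i x)\<bar> \<le> norm x" by (rule limit_functional_bound[OF \<Lambda> norm])
qed

section \<open>Limits over tuples and over interlaced pairs\<close>

primrec iterated_limit :: "((nat \<Rightarrow> real) \<Rightarrow> real) \<Rightarrow> nat \<Rightarrow> (nat list \<Rightarrow> real) \<Rightarrow> real" where
  "iterated_limit U 0 F = F []"
| "iterated_limit U (Suc k) F = U (\<lambda>n. iterated_limit U k (\<lambda>l. F (n # l)))"

text \<open>Limits over the two tuples alternate entry by entry; this order makes interlaced pairs
  available as witnesses.\<close>

primrec interlaced_limit ::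
  "((nat \<Rightarrow> real) \<Rightarrow> real) \<Rightarrow> nat \<Rightarrow> (nat list \<times> nat list \<Rightarrow> real) \<Rightarrow> real" where
  "interlaced_limit U 0 F = F ([], [])"
| "interlaced_limit U (Suc k) F =
     U (\<lambda>n. U (\<lambda>m. interlaced_limit U k (\<lambda>p. F (n # fst p, m # snd p))))"

text \<open>\<open>N\<close> carries the last entry used, and as a free parameter it pushes a second
  pair beyond a first one.\<close>

fun interlaced :: "nat \<Rightarrow> nat list \<Rightarrow> nat list \<Rightarrow> bool" where
  "interlaced N [] [] \<longleftrightarrow> True"
| "interlaced N (n # l) (m # r) \<longleftrightarrow> N < n \<and> n < m \<and> interlaced m l r"
| "interlaced N _ _ \<longleftrightarrow> False"

lemma interlaced_length: "interlaced N l r \<Longrightarrow> length r = length l"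
  by (induction N l r rule: interlaced.induct) auto

lemma interlaced_greater: "interlaced N l r \<Longrightarrow> a \<in> set l \<union> set r \<Longrightarrow> N < a"
  by (induction N l r rule: interlaced.induct) force+

lemma interlaced_limit_fst:
  assumes "limit_functional S U"
  shows "interlaced_limit U k (\<lambda>p. G (fst p)) = iterated_limit U k G"
proof (induction k arbitrary: G)
  case (Suc k)
  have "interlaced_limit U k (\<lambda>p. G (n # fst p)) = iterated_limit U k (\<lambda>l. G (n # l))" for n
    using Suc[of "\<lambda>l. G (n # l)"] .
  then show ?case by (simp add: limit_functional_const[OF assms])
qed simp

lemma limit_functional_iterated:
  assumes "limit_functional S U"
  shows "limit_functional UNIV (iterated_limit U k)"
proof (induction k)
  case 0
  show ?case by (auto simp: limit_functional_def intro!: exI[of _ "[]"])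
next
  case (Suc k)
  have "limit_functional (S \<times> UNIV) (\<lambda>F. U (\<lambda>n. iterated_limit U k (\<lambda>l. F (n, l))))"
    by (rule limit_functional_Sigma[OF assms Suc])
  from limit_functional_image[OF this, of "\<lambda>p. fst p # snd p"]
  have "limit_functional ((\<lambda>p. fst p # snd p) ` (S \<times> UNIV)) (iterated_limit U (Suc k))"
    by (simp add: iterated_limit_def)
  then show ?case by (rule limit_functional_mono) simp
qed

text \<open>Each entry is chosen in the tail beyond the previous one, by a dependent product of
  limits.\<close>

lemma limit_functional_interlaced:
  assumes "\<And>N. limit_functional {N<..} U"
  shows "limit_functional {p. interlaced N (fst p) (snd p) \<and> length (fst p) = k} (interlaced_limit U k)"
proof (induction k arbitrary: N)
  case 0
  show ?case unfolding limit_functional_def by (intro allI impI bexI[of _ "([], [])"]) auto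
next
  case (Suc k)
  let ?T = "\<lambda>m. {p. interlaced m (fst p) (snd p) \<and> length (fst p) = k}"
  let ?h = "\<lambda>q. (fst q # fst (snd (snd q)), fst (snd q) # snd (snd (snd q)))"
  have "limit_functional (SIGMA n:{N<..}. SIGMA m:{n<..}. ?T m)
      (\<lambda>F. U (\<lambda>n. U (\<lambda>m. interlaced_limit U k (\<lambda>p. F (n, m, p)))))"
    by (rule limit_functional_Sigma[OF assms limit_functional_Sigma[OF assms Suc]])
  from limit_functional_image[OF this, of ?h]
  have "limit_functional (?h ` (SIGMA n:{N<..}. SIGMA m:{n<..}. ?T m)) (interlaced_limit U (Suc k))"
    by (simp add: interlaced_limit_def)
  then show ?case by (rule limit_functional_mono) auto
qed

text \<open>The induction hypothesis separates the remaining entries; then the limit over the first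
  entry \<open>n\<close> moves past the limits over the whole second tuple by
  \<open>double_limit\<close>.\<close>

lemma interlaced_limit_eq_iterated:
  fixes x :: "nat list \<Rightarrow> 'a::banach"
  assumes uc: "uniformly_convex TYPE('a)" and U: "limit_functional S U"
    and x: "\<And>r. norm (x r) \<le> B"
    and lin: "\<And>l. linear (\<phi> l)" and norm: "\<And>l v. \<bar>\<phi> l v\<bar> \<le> norm v"
  shows "interlaced_limit U k (\<lambda>p. \<phi> (fst p) (x (snd p))) =
    iterated_limit U k (\<lambda>r. iterated_limit U k (\<lambda>l. \<phi> l (x r)))"
  using x lin norm
proof (induction k arbitrary: \<phi> x)
  case (Suc k)
  note IL = limit_functional_iterated[OF U]
  define \<psi> where "\<psi> n v = iterated_limit U k (\<lambda>l. \<phi> (n # l) v)" for n v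
  have \<psi>: "linear (\<psi> n)" "\<bar>\<psi> n v\<bar> \<le> norm v" for n v
    unfolding \<psi>_def using limit_functional_pointwise_linear[OF IL Suc.prems(2,3)] by blast+
  have "interlaced_limit U (Suc k) (\<lambda>p. \<phi> (fst p) (x (snd p))) =
      U (\<lambda>n. iterated_limit U (Suc k) (\<lambda>r. \<psi> n (x r)))"
    unfolding interlaced_limit.simps iterated_limit.simps fst_conv snd_conv \<psi>_def
    by (subst Suc.IH) (use Suc.prems in auto)
  also have "\<dots> = iterated_limit U (Suc k) (\<lambda>r. U (\<lambda>n. \<psi> n (x r)))"
    by (rule double_limit[OF uc U IL Suc.prems(1) \<psi>])
  also have "\<dots> = iterated_limit U (Suc k) (\<lambda>r. iterated_limit U (Suc k) (\<lambda>l. \<phi> l (x r)))"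
    by (simp add: \<psi>_def)
  finally show ?case .
qed simp

text \<open>Kalton's concentration phenomenon for the interlacing graphs. The functionals norming
  \<open>f l - f r\<close> are tested on the interlaced neighbours of \<open>l\<close> and \<open>r\<close>; after exchanging limits,
  the two resulting terms cancel.\<close>
lemma interlaced_concentration:
  fixes f :: "nat list \<Rightarrow> 'a::banach"
  assumes uc: "uniformly_convex TYPE('a)" and B: "\<And>l. norm (f l) \<le> B"
    and L: "\<And>N l r. interlaced N l r \<Longrightarrow> length l = k \<Longrightarrow> norm (f l - f r) \<le> L"
  obtains l r where "length l = k" "length r = k" "\<And>a b. a \<in> set l \<Longrightarrow> b \<in> set r \<Longrightarrow> a < b"
    "norm (f l - f r) \<le> 2 * L + 1"
proof -
  obtain U :: "(nat \<Rightarrow> real) \<Rightarrow> real" where U: "\<And>N. limit_functional {N<..} U"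
    using limit_functional_exists by blast
  note IL = limit_functional_iterated[OF U, of k] and IN = limit_functional_interlaced[OF U, of _ k]
  have "\<exists>\<phi>. linear \<phi> \<and> (\<forall>x. \<bar>\<phi> x\<bar> \<le> norm x) \<and> \<phi> (f l - f r) = norm (f l - f r)" for l r
    by (rule norming_functional[of "f l - f r"]) blast
  then obtain \<phi> where lin: "\<And>l r. linear (\<phi> l r)" and norm: "\<And>l r x. \<bar>\<phi> l r x\<bar> \<le> norm x"
    and \<phi>: "\<And>l r. \<phi> l r (f l - f r) = norm (f l - f r)"
    by metis
  have \<phi>f: "\<bar>\<phi> l r (f l')\<bar> \<le> B" for l r l' using norm[of l r "f l'"] B[of l'] by linarith
  define \<psi> where "\<psi> l v = iterated_limit U k (\<lambda>r. \<phi> l r v)" for l v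
  have \<psi>: "linear (\<psi> l)" "\<bar>\<psi> l v\<bar> \<le> norm v" for l v
    unfolding \<psi>_def using limit_functional_pointwise_linear[OF IL, of "\<phi> l"] lin norm by blast+
  have \<psi>f: "\<bar>\<psi> l (f l')\<bar> \<le> B" for l l' using \<psi>(2)[of l "f l'"] B[of l'] by linarith
  \<comment> \<open>\<open>p\<close> and \<open>q\<close> are \<open>l\<close> and \<open>r\<close>
    with their interlaced partners. The functional norming \<open>f l - f r\<close> is tested on the
    partners, and \<open>E\<close> is the limit over \<open>q\<close>.\<close>
  define D where "D p q = \<phi> (fst p) (fst q) (f (snd p)) - \<phi> (fst p) (fst q) (f (snd q))" for p q
  define E where "E p = interlaced_limit U k (D p)" for p
  have bd: "bounded (range (D p))" for p
  proof -
    have "\<bar>D p q\<bar> \<le> 2 * B" for q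
      using \<phi>f[of "fst p" "fst q" "snd p"] \<phi>f[of "fst p" "fst q" "snd q"] by (simp add: D_def)
    then show ?thesis unfolding bounded_range_abs by blast
  qed
  have E: "E p = \<psi> (fst p) (f (snd p)) - iterated_limit U k (\<lambda>r'. \<psi> (fst p) (f r'))" for p
  proof -
    have "interlaced_limit U k (\<lambda>q. \<phi> (fst p) (fst q) (f (snd p))) = \<psi> (fst p) (f (snd p))"
      using interlaced_limit_eq_iterated[OF uc U, of "\<lambda>_. f (snd p)" B "\<phi> (fst p)" k] B lin norm
      by (simp add: \<psi>_def limit_functional_const[OF IL])
    moreover have "interlaced_limit U k (\<lambda>q. \<phi> (fst p) (fst q) (f (snd q))) =
        iterated_limit U k (\<lambda>r'. \<psi> (fst p) (f r'))"
      using interlaced_limit_eq_iterated[OF uc U, of f B "\<phi> (fst p)" k] B lin norm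
      by (simp add: \<psi>_def)
    moreover have "interlaced_limit U k (D p) =
        interlaced_limit U k (\<lambda>q. \<phi> (fst p) (fst q) (f (snd p))) -
        interlaced_limit U k (\<lambda>q. \<phi> (fst p) (fst q) (f (snd q)))"
      unfolding D_def
      by (rule limit_functional_diff[OF IN]) (use \<phi>f in \<open>auto simp: bounded_range_abs\<close>)
    ultimately show ?thesis unfolding E_def by simp
  qed
  have J: "\<bar>iterated_limit U k (\<lambda>r'. \<psi> l (f r'))\<bar> \<le> B" for l
    by (rule limit_functional_bound[OF IL \<psi>f])
  \<comment> \<open>The two terms of \<open>E\<close> become the iterated limits of
    \<open>\<psi> l (f r')\<close> in opposite orders.\<close>
  have E0: "interlaced_limit U k E = 0"
  proof -
    have "bounded (range (\<lambda>p. \<psi> (fst p) (f (snd p))))"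
      "bounded (range (\<lambda>p. iterated_limit U k (\<lambda>r'. \<psi> (fst p) (f r'))))"
      by (auto simp: bounded_range_abs intro!: exI[of _ B] \<psi>f J)
    moreover have "E = (\<lambda>p. \<psi> (fst p) (f (snd p)) - iterated_limit U k (\<lambda>r'. \<psi> (fst p) (f r')))"
      using E by blast
    ultimately have "interlaced_limit U k E = interlaced_limit U k (\<lambda>p. \<psi> (fst p) (f (snd p))) -
        interlaced_limit U k (\<lambda>p. iterated_limit U k (\<lambda>r'. \<psi> (fst p) (f r')))"
      using limit_functional_diff[OF IN] by simp
    also have "interlaced_limit U k (\<lambda>p. \<psi> (fst p) (f (snd p))) =
        iterated_limit U k (\<lambda>l'. iterated_limit U k (\<lambda>l. \<psi> l (f l')))"
      by (rule interlaced_limit_eq_iterated[OF uc U B \<psi>])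
    also have "interlaced_limit U k (\<lambda>p. iterated_limit U k (\<lambda>r'. \<psi> (fst p) (f r'))) =
        iterated_limit U k (\<lambda>l. iterated_limit U k (\<lambda>r'. \<psi> l (f r')))"
      by (rule interlaced_limit_fst[OF U])
    also have "\<dots> = iterated_limit U k (\<lambda>r'. iterated_limit U k (\<lambda>l. \<psi> l (f r')))"
      by (rule double_limit[OF uc IL IL B \<psi>])
    finally show ?thesis by simp
  qed
  have bdE: "bounded (range E)"
    unfolding bounded_range_abs
  proof (intro exI allI)
    show "\<bar>E p\<bar> \<le> 2 * B" for p
      using \<psi>f[of "fst p" "snd p"] J[of "fst p"] by (simp add: E)
  qed
  \<comment> \<open>Two approximations within 1 / 2, of 0 by \<open>E p\<close> and of
    \<open>E p\<close> by \<open>D p q\<close>, account for the summand 1.\<close>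
  obtain p where "p \<in> {p. interlaced 0 (fst p) (snd p) \<and> length (fst p) = k}"
    "\<bar>E p - interlaced_limit U k E\<bar> < 1 / 2"
    by (rule limit_functional_witness[OF IN bdE, of "1 / 2"]) simp
  then have p: "interlaced 0 (fst p) (snd p)" "length (fst p) = k" "\<bar>E p\<bar> < 1 / 2"
    by (simp_all add: E0)
  \<comment> \<open>The sum bounds every entry of the first tuple, so a pair beyond \<open>N\<close>
    lies after all of them.\<close>
  define N where "N = sum_list (fst p)"
  obtain q where "q \<in> {q. interlaced N (fst q) (snd q) \<and> length (fst q) = k}"
    "\<bar>D p q - interlaced_limit U k (D p)\<bar> < 1 / 2"
    by (rule limit_functional_witness[OF IN bd[of p], of "1 / 2"]) simp
  then have q: "interlaced N (fst q) (snd q)" "length (fst q) = k" "\<bar>D p q - E p\<bar> < 1 / 2"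
    by (simp_all add: E_def)
  let ?l = "fst p" and ?r = "fst q"
  \<comment> \<open>Passing from a tuple to its partner costs at most \<open>L\<close>, since the
    functional has norm at most 1.\<close>
  have "norm (f ?l - f ?r) = D p q + \<phi> ?l ?r (f ?l - f (snd p)) - \<phi> ?l ?r (f ?r - f (snd q))"
    unfolding D_def \<phi>[symmetric] by (simp add: linear_diff[OF lin])
  also have "\<dots> \<le> 1 + L + L"
    using p(3) q(3) norm[of ?l ?r "f ?l - f (snd p)"] norm[of ?l ?r "f ?r - f (snd q)"]
      L[OF p(1,2)] L[OF q(1,2)] by linarith
  finally have "norm (f ?l - f ?r) \<le> 2 * L + 1" by simp
  moreover have "a < b" if "a \<in> set ?l" "b \<in> set ?r" for a b
    using member_le_sum_list[OF that(1)] interlaced_greater[OF q(1), of b] that(2)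
    by (simp add: N_def)
  ultimately show ?thesis using p(2) q(2) by (intro that[of ?l ?r]) auto
qed

section \<open>Finite ultrametric spaces of tuples\<close>

definition height :: "nat list \<Rightarrow> nat \<Rightarrow> nat" where
  "height l i = length (filter (\<lambda>a. i \<le> a) l)"

definition level_space :: "nat list \<Rightarrow> nat metric" where
  "level_space l = metric ({i. 0 < height l i},
     \<lambda>i j. if i = j then 0 else real (max (height l i) (height l j)))"

lemma level_space_simps [simp]:
  "mspace (level_space l) = {i. 0 < height l i}"
  "mdist (level_space l) = (\<lambda>i j. if i = j then 0 else real (max (height l i) (height l j)))"
proof -
  interpret Metric_space "{i. 0 < height l i}"
    "\<lambda>i j. if i = j then 0 else real (max (height l i) (height l j))"
    by unfold_locales auto
  show "mspace (level_space l) = {i. 0 < height l i}"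
    "mdist (level_space l) = (\<lambda>i j. if i = j then 0 else real (max (height l i) (height l j)))"
    by (simp_all add: level_space_def)
qed

lemma height_pos_iff: "0 < height l i \<longleftrightarrow> (\<exists>a\<in>set l. i \<le> a)"
  by (auto simp: height_def filter_empty_conv)

lemma height_le_length: "height l i \<le> length l"
  by (simp add: height_def)

lemma height_eq_length: "(\<And>a. a \<in> set l \<Longrightarrow> i \<le> a) \<Longrightarrow> height l i = length l"
  by (simp add: height_def)

lemma finite_level_space: "finite {i. 0 < height l i}"
proof -
  have "{i. 0 < height l i} = (\<Union>a\<in>set l. {..a})" by (auto simp: height_pos_iff)
  then show ?thesis by simp
qed

lemma isometric_finite_level_space:
  assumes "l \<noteq> []" shows "isometric_finite (level_space l) (level_space l)"
proof -
  have "0 < height l 0" using assms by (simp add: height_def)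
  then have "{i. 0 < height l i} \<noteq> {}" by blast
  then show ?thesis using finite_level_space[of l] by (simp add: isometric_finite_def isometric_refl)
qed

text \<open>The entries alternate, so \<open>i\<close> can separate at most one entry of
  \<open>l\<close> from its larger partner in \<open>r\<close>.\<close>

lemma height_interlaced:
  assumes "interlaced N l r"
  shows "height l i \<le> height r i" "height r i \<le> Suc (height l i)"
proof -
  show "height l i \<le> height r i"
    using assms by (induction N l r rule: interlaced.induct) (auto simp: height_def)
  show "height r i \<le> Suc (height l i)"
    using assms
  proof (induction N l r rule: interlaced.induct)
    case (2 N n l m r)
    show ?case
    proof (cases "i \<le> m")
      case True
      have "i \<le> a" if "a \<in> set l \<union> set r" for a
        using interlaced_greater[of m l r a] 2(2) that True by force
      then have "height l i = length l" "height r i = length r"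
        by (auto intro!: height_eq_length)
      then show ?thesis using 2(2) interlaced_length[of m l r] by (simp add: height_def)
    next
      case False
      then show ?thesis using 2 by (auto simp: height_def)
    qed
  qed (auto simp: height_def)
qed

lemma ex_height_one: "distinct l \<Longrightarrow> l \<noteq> [] \<Longrightarrow> \<exists>i. height l i = 1"
proof (intro exI)
  assume l: "distinct l" "l \<noteq> []"
  have "filter (\<lambda>a. Max (set l) \<le> a) l = filter (\<lambda>a. a = Max (set l)) l"
    by (rule filter_cong) (auto intro: antisym Max_ge)
  then show "height l (Max (set l)) = 1"
    using l by (simp add: height_def distinct_length_filter Int_absorb2)
qed

lemma interlaced_distinct: "interlaced N l r \<Longrightarrow> distinct l \<and> distinct r"
proof (induction N l r rule: interlaced.induct)
  case (2 N n l m r)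
  have "n \<notin> set l" "m \<notin> set r" using interlaced_greater[of m l r] 2(2) by force+
  then show ?case using 2 by simp
qed auto

section \<open>Gromov-Hausdorff estimates for spaces of tuples\<close>

lemma GH_distance_interlaced:
  assumes lr: "interlaced N l r" and ne: "l \<noteq> []"
  shows "GH_distance (level_space l) (level_space r) \<le> 1"
proof -
  \<comment> \<open>The identity, enlarged by all pairs of height at most 1: points missing from the
    first space have height 1 in the second. If a pair of points collapses on one side, its distance
    on the other side is at most 2.\<close>
  let ?R = "{(i, j). 0 < height l i \<and> 0 < height r j \<and> (i = j \<or> height l i \<le> 1 \<and> height r j \<le> 1)}"
  note h = height_interlaced[OF lr]
  obtain i0 where i0: "height l i0 = 1"
    using ex_height_one interlaced_distinct[OF lr] ne by blast
  have "mspace (level_space l) \<noteq> {}" using i0 by (auto intro!: exI[of _ i0])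
  moreover have "correspondence (mspace (level_space l)) (mspace (level_space r)) ?R"
    unfolding correspondence_def
  proof (intro conjI ballI)
    fix i assume "i \<in> mspace (level_space l)"
    then show "\<exists>j\<in>mspace (level_space r). (i, j) \<in> ?R" using h(1)[of i] by (intro bexI[of _ i]) auto
  next
    fix j assume j: "j \<in> mspace (level_space r)"
    show "\<exists>i\<in>mspace (level_space l). (i, j) \<in> ?R"
    proof (cases "0 < height l j")
      case True
      then show ?thesis using j by (intro bexI[of _ j]) auto
    next
      case False
      then show ?thesis using j h(2)[of j] i0 by (intro bexI[of _ i0]) auto
    qed
  qed auto
  moreover have "distortion_le (level_space l) (level_space r) ?R (2 * 1)"
    unfolding distortion_le_def
  proof (intro allI impI)
    fix i j i' j' assume "(i, j) \<in> ?R" "(i', j') \<in> ?R"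
    then show "\<bar>mdist (level_space l) i i' - mdist (level_space r) j j'\<bar> \<le> 2 * 1"
      using h[of i] h[of i'] by (auto simp: max_def)
  qed
  ultimately have "GH_distance (level_space l) (level_space r) \<le> ereal 1" by (rule GH_distance_le)
  then show ?thesis by (simp add: one_ereal_def)
qed

text \<open>Two points of the second space must share a partner, by the pigeonhole principle.\<close>
lemma GH_distance_separated:
  assumes k: "length l = k" "length r = k" "0 < k"
    and sep: "\<And>a b. a \<in> set l \<Longrightarrow> b \<in> set r \<Longrightarrow> a < b"
  shows "ereal (k / 4) \<le> GH_distance (level_space l) (level_space r)"
proof (rule ccontr)
  assume "\<not> ?thesis"
  then have "GH_distance (level_space l) (level_space r) < ereal (k / 4)" by simp
  then obtain R where R: "correspondence (mspace (level_space l)) (mspace (level_space r)) R"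
    and dis: "distortion_le (level_space l) (level_space r) R (2 * (k / 4))"
    by (rule GH_distance_lessE)
  \<comment> \<open>All \<open>b + 1\<close> points up to \<open>b\<close> have height
    \<open>k\<close> in the second space, while the first space lies strictly below
    \<open>b\<close>.\<close>
  define b where "b = Min (set r)"
  have "set r \<noteq> {}" using k by auto
  then have b: "b \<in> set r" unfolding b_def by (intro Min_in) simp_all
  have height_b: "height r i = k" if "i \<le> b" for i
  proof -
    have "i \<le> a" if "a \<in> set r" for a
      using Min_le[OF _ that] \<open>i \<le> b\<close> unfolding b_def by simp
    then show ?thesis using k by (simp add: height_eq_length)
  qed
  have "\<exists>i. (i, j) \<in> R" if "j \<le> b" for j
  proof -
    have "j \<in> mspace (level_space r)" using height_b[OF that] k by simp
    then show ?thesis using R unfolding correspondence_def by blast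
  qed
  then obtain g where g: "\<And>j. j \<le> b \<Longrightarrow> (g j, j) \<in> R" by metis
  have "g ` {..b} \<subseteq> {..<b}"
  proof clarsimp
    fix j assume "j \<le> b"
    from g[OF this] have "0 < height l (g j)" using R unfolding correspondence_def by auto
    then obtain a where "a \<in> set l" "g j \<le> a" by (auto simp: height_pos_iff)
    with sep[OF _ b] show "g j < b" by force
  qed
  then have "card (g ` {..b}) \<le> card {..<b}" by (intro card_mono) auto
  then have "\<not> inj_on g {..b}" by (intro pigeonhole) simp
  then obtain j j' where j: "j \<le> b" "j' \<le> b" "g j = g j'" "j \<noteq> j'" by (auto simp: inj_on_def)
  \<comment> \<open>A common partner turns distance \<open>k\<close> into 0, but the distortion is
    at most \<open>k / 2\<close>.\<close>
  have "\<bar>mdist (level_space l) (g j) (g j') - mdist (level_space r) j j'\<bar> \<le> 2 * (k / 4)"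
    using dis g[OF j(1)] g[OF j(2)] unfolding distortion_le_def by blast
  then show False using j height_b k by simp
qed

text \<open>The upper control function of a coarse embedding need not be monotone, so it can only be bounded
  on a set of distances that is known to be finite; hence the interest in half-integer distances.\<close>
lemma GH_distance_half_integer:
  assumes ne: "mspace X \<noteq> {}" "mspace Y \<noteq> {}" and fin: "finite (mspace X)" "finite (mspace Y)"
    and int: "\<And>x x'. mdist X x x' \<in> \<int>" "\<And>y y'. mdist Y y y' \<in> \<int>"
  obtains m :: nat where "GH_distance X Y = ereal (m / 2)"
proof -
  obtain d where d: "GH_distance X Y = ereal d" "0 \<le> d"
    using GH_distance_finite[OF ne fin] GH_distance_nonneg[OF ne(1), of Y]
    by (cases "GH_distance X Y") auto
  define m where "m = nat \<lfloor>2 * d\<rfloor>"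
  have m: "real m \<le> 2 * d" "2 * d < real m + 1"
    using d(2) by (auto simp: m_def le_nat_floor of_nat_floor)
  \<comment> \<open>\<open>2 * c\<close> is the midpoint of \<open>2 * d\<close> and
    \<open>m + 1\<close>, so integral distortions up to \<open>2 * c\<close> are at most
    \<open>m\<close>.\<close>
  define c where "c = (2 * d + real m + 1) / 4"
  have "GH_distance X Y < ereal c" using d m by (simp add: c_def)
  then obtain R where R: "correspondence (mspace X) (mspace Y) R" "distortion_le X Y R (2 * c)"
    by (rule GH_distance_lessE)
  have "distortion_le X Y R (2 * (real m / 2))"
    unfolding distortion_le_def
  proof (intro allI impI)
    fix x y x' y' assume xy: "(x, y) \<in> R" "(x', y') \<in> R"
    obtain z where z: "\<bar>mdist X x x' - mdist Y y y'\<bar> = of_int z"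
      using int(1)[of x x'] int(2)[of y y'] by (metis Ints_abs Ints_cases Ints_diff)
    have "of_int z \<le> 2 * c"
      using R(2) xy unfolding distortion_le_def z[symmetric] by blast
    then have "of_int z < real_of_int (int m + 1)" using m by (simp add: c_def)
    then have "z < int m + 1" by (simp only: of_int_less_iff)
    then show "\<bar>mdist X x x' - mdist Y y y'\<bar> \<le> 2 * (real m / 2)" unfolding z by simp
  qed
  then have "GH_distance X Y \<le> ereal (real m / 2)" by (rule GH_distance_le[OF ne(1) R(1)])
  then have "d = real m / 2" using d m by simp
  then show ?thesis using d that by simp
qed

section \<open>Distances between the isometry classes\<close>

definition level_class :: "nat list \<Rightarrow> finite_metric_class" where
  "level_class l = abs_finite_metric_class (level_space l)"

lemma dist_level_class:
  assumes "l \<noteq> []" "r \<noteq> []"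
  obtains m :: nat where "GH_distance (level_space l) (level_space r) = ereal (m / 2)"
    "dist (level_class l) (level_class r) = m / 2"
proof -
  note iso = isometric_finite_level_space[OF assms(1)] isometric_finite_level_space[OF assms(2)]
  obtain m :: nat where m: "GH_distance (level_space l) (level_space r) = ereal (m / 2)"
    by (rule GH_distance_half_integer[of "level_space l" "level_space r"])
      (use iso in \<open>auto simp: isometric_finite_def\<close>)
  moreover have "dist (level_class l) (level_class r) = m / 2"
    using iso m by (simp add: level_class_def dist_finite_metric_class.abs_eq)
  ultimately show ?thesis by (rule that)
qed

text \<open>Relating all points to all points has distortion at most \<open>k\<close>. Finitely many
  possible distances allow the upper control function to bound the image of all tuples of length
  \<open>k\<close>.\<close>

lemma dist_level_class_bounded:
  assumes "length l = k" "length r = k" "0 < k"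
  shows "dist (level_class l) (level_class r) \<in> (\<lambda>m. real m / 2) ` {..k}"
proof -
  have ne: "l \<noteq> []" "r \<noteq> []" using assms by auto
  have ne': "mspace (level_space l) \<noteq> {}" "mspace (level_space r) \<noteq> {}"
    using isometric_finite_level_space[OF ne(1)] isometric_finite_level_space[OF ne(2)]
    by (auto simp: isometric_finite_def)
  obtain m :: nat where m: "GH_distance (level_space l) (level_space r) = ereal (m / 2)"
    "dist (level_class l) (level_class r) = m / 2"
    using dist_level_class[OF ne] .
  have d: "0 \<le> mdist (level_space s) i j" "mdist (level_space s) i j \<le> length s" for s i j
    using height_le_length[of s i] height_le_length[of s j] by auto
  have "GH_distance (level_space l) (level_space r) \<le> ereal (k / 2)"
  proof (rule GH_distance_le[OF ne'(1)])
    show "correspondence (mspace (level_space l)) (mspace (level_space r))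
        (mspace (level_space l) \<times> mspace (level_space r))"
      using ne' by (auto simp: correspondence_def)
    show "distortion_le (level_space l) (level_space r)
        (mspace (level_space l) \<times> mspace (level_space r)) (2 * (k / 2))"
      unfolding distortion_le_def
    proof (intro allI impI)
      fix i j i' j'
      show "\<bar>mdist (level_space l) i i' - mdist (level_space r) j j'\<bar> \<le> 2 * (k / 2)"
        using d[of l i i'] d[of r j j'] assms(1,2) by linarith
    qed
  qed
  then show ?thesis using m by auto
qed

lemma dist_level_class_interlaced:
  assumes "interlaced N l r" "l \<noteq> []"
  shows "dist (level_class l) (level_class r) \<in> {0, 1 / 2, 1}"
proof -
  have "r \<noteq> []" using assms interlaced_length by force
  then obtain m :: nat where m: "GH_distance (level_space l) (level_space r) = ereal (m / 2)"
    "dist (level_class l) (level_class r) = m / 2"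
    using dist_level_class[OF assms(2)] by blast
  then have "m \<le> 2" using GH_distance_interlaced[OF assms] by (simp add: one_ereal_def)
  then show ?thesis using m by (auto simp: le_Suc_eq numeral_2_eq_2)
qed

section \<open>Contradiction with a coarse embedding, and the Hilbert space case\<close>

lemma not_coarse_embedding_uniformly_convex:
  fixes \<psi> :: "finite_metric_class \<Rightarrow> 'a::banach"
  assumes uc: "uniformly_convex TYPE('a)" and \<psi>: "coarse_embedding \<psi>"
  shows False
proof -
  obtain \<rho>m \<rho>p :: "real \<Rightarrow> real" where lim: "filterlim \<rho>m at_top at_top"
    and lower: "\<And>x y. \<rho>m (dist x y) \<le> dist (\<psi> x) (\<psi> y)"
    and upper: "\<And>x y. dist (\<psi> x) (\<psi> y) \<le> \<rho>p (dist x y)"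
    using \<psi> unfolding coarse_embedding_def by metis
  \<comment> \<open>Only the three distances possible for interlaced tuples enter, so
    \<open>L\<close> does not depend on the length \<open>k\<close> chosen below.\<close>
  define L where "L = Max (\<rho>p ` {0, 1 / 2, 1})"
  have L: "\<rho>p t \<le> L" if "t \<in> {0, 1 / 2, 1}" for t
    unfolding L_def using that by (intro Max_ge imageI) simp_all
  \<comment> \<open>The bound exceeds the \<open>2 * L + 1\<close> of the concentration
    lemma.\<close>
  obtain T where T: "\<And>t. t \<ge> T \<Longrightarrow> 2 * L + 2 \<le> \<rho>m t"
    using lim unfolding filterlim_at_top eventually_at_top_linorder by blast
  \<comment> \<open>Separated tuples are at distance at least \<open>k / 4\<close>, which has to
    reach \<open>T\<close>.\<close>
  obtain n :: nat where "4 * T \<le> n" using real_arch_simple by blast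
  then obtain k :: nat where k: "T \<le> k / 4" "0 < k" by (intro that[of "Suc n"]) auto
  \<comment> \<open>The default 0 keeps \<open>f\<close> bounded on lists of every length.\<close>
  define f where "f l = (if length l = k then \<psi> (level_class l) else 0)" for l
  define B where "B = Max (\<rho>p ` (\<lambda>m. real m / 2) ` {..k}) + norm (\<psi> (level_class (replicate k 0)))"
  have B: "norm (\<psi> (level_class l)) \<le> B" if "length l = k" for l
  proof -
    let ?z = "level_class (replicate k 0)"
    have "\<rho>p (dist (level_class l) ?z) \<le> Max (\<rho>p ` (\<lambda>m. real m / 2) ` {..k})"
      using dist_level_class_bounded[of l k "replicate k 0"] that k by (intro Max_ge) auto
    with upper[of "level_class l" ?z] norm_triangle_sub[of "\<psi> (level_class l)" "\<psi> ?z"]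
    show ?thesis by (simp add: B_def dist_norm)
  qed
  have bound: "norm (f l) \<le> max B 0" for l
    using B[of l] by (cases "length l = k") (auto simp: f_def intro: max.coboundedI1)
  have lipschitz: "norm (f l - f r) \<le> L" if lr: "interlaced N l r" "length l = k" for N l r
  proof -
    have "l \<noteq> []" "length r = k" using lr k interlaced_length by auto
    then show ?thesis
      using L[OF dist_level_class_interlaced[OF lr(1)]] upper[of "level_class l" "level_class r"] lr(2)
      by (simp add: f_def dist_norm)
  qed
  obtain l r where lr: "length l = k" "length r = k"
    "\<And>a b. a \<in> set l \<Longrightarrow> b \<in> set r \<Longrightarrow> a < b" "norm (f l - f r) \<le> 2 * L + 1"
    by (rule interlaced_concentration[of f _ k L, OF uc bound lipschitz]) (assumption | blast)+
  have "l \<noteq> []" "r \<noteq> []" using lr k by auto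
  then obtain m :: nat where m: "GH_distance (level_space l) (level_space r) = ereal (m / 2)"
    "dist (level_class l) (level_class r) = m / 2" by (rule dist_level_class)
  have "k / 4 \<le> dist (level_class l) (level_class r)"
    using GH_distance_separated[OF lr(1,2) k(2) lr(3)] m by simp
  then have "2 * L + 2 \<le> \<rho>m (dist (level_class l) (level_class r))" using k by (intro T) simp
  with lower[of "level_class l" "level_class r"] lr show False by (simp add: f_def dist_norm)
qed

text \<open>The parallelogram law turns the lower bound on the difference into an upper bound on the
  midpoint, with an explicit \<delta>.\<close>

lemma uniformly_convex_inner: "uniformly_convex TYPE('h::{real_inner, banach})"
  unfolding uniformly_convex_def
proof (intro allI impI)
  fix \<epsilon> :: real assume \<epsilon>: "0 < \<epsilon> \<and> \<epsilon> \<le> 2"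
  define \<delta> where "\<delta> = 1 - sqrt (1 - \<epsilon>\<^sup>2 / 4)"
  have "norm ((1 / 2) *\<^sub>R (x + y)) \<le> 1 - \<delta>"
    if "norm x = 1" "norm y = 1" "\<epsilon> \<le> norm (x - y)" for x y :: 'h
  proof -
    have "\<epsilon>\<^sup>2 \<le> (norm (x - y))\<^sup>2" using that(3) \<epsilon> by (intro power_mono) auto
    moreover have "(norm (x + y))\<^sup>2 + (norm (x - y))\<^sup>2 = 2 * (norm x)\<^sup>2 + 2 * (norm y)\<^sup>2"
      by (simp add: power2_norm_eq_inner inner_add inner_diff inner_commute)
    ultimately have "(norm (x + y) / 2)\<^sup>2 \<le> 1 - \<epsilon>\<^sup>2 / 4"
      using that by (simp add: power_divide)
    then have "norm (x + y) / 2 \<le> sqrt (1 - \<epsilon>\<^sup>2 / 4)" by (rule real_le_rsqrt)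
    then show ?thesis by (simp add: \<delta>_def)
  qed
  moreover have "\<delta> > 0" using \<epsilon> by (simp add: \<delta>_def)
  ultimately show "\<exists>\<delta>>0. \<forall>x y :: 'h. norm x = 1 \<longrightarrow> norm y = 1 \<longrightarrow> norm (x - y) \<ge> \<epsilon> \<longrightarrow>
      norm ((1 / 2) *\<^sub>R (x + y)) \<le> 1 - \<delta>"
    by blast
qed

theorem theorem2:
  shows "(uniformly_convex TYPE('b::banach) \<longrightarrow>
            \<not> (\<exists>\<psi> :: finite_metric_class \<Rightarrow> 'b. coarse_embedding \<psi>)) \<and>
         \<not> (\<exists>\<psi> :: finite_metric_class \<Rightarrow> 'h::{real_inner, banach}. coarse_embedding \<psi>)"
  using not_coarse_embedding_uniformly_convex[where 'a = 'b]
    not_coarse_embedding_uniformly_convex[where 'a = 'h, OF uniformly_convex_inner]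
  by blast

end
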